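(* Let $\mathbf n=(n_1,\dots,n_k)\in\mathbb N^k$, let $\mathcal E$ be a Hilbert space, and let $\boldsymbol{\mathcal T}_{\mathbf n}$ be the set of all $k$-multi-Toeplitz operators on $\mathcal E\otimes\bigotimes_{i=1}^kF^2(H_{n_i})$. Then $$\boldsymbol{\mathcal T}_{\mathbf n}=\operatorname{span}\{f^*g:\ f,g\in B(\mathcal E)\otimes_{min}\boldsymbol{\mathcal A}_{\mathbf n}\}^{-\mathrm{SOT}}=\operatorname{span}\{f^*g:\ f,g\in B(\mathcal E)\otimes_{min}\boldsymbol{\mathcal A}_{\mathbf n}\}^{-\mathrm{WOT}},$$ where $\boldsymbol{\mathcal A}_{\mathbf n}$ is the polyball algebra.
   Context: Here $\mathbb N=\{1,2,\dots\}$. For $i=1,\dots,k$ let $H_{n_i}$ be an $n_i$-dimensional complex Hilbert space with orthonormal basis $e^i_1,\dots,e^i_{n_i}$, $F^2(H_{n_i})=\mathbb C1\oplus\bigoplus_{p\ge1}H_{n_i}^{\otimes p}$ its full Fock space, and $\mathbb F_{n_i}^+$ the unital free semigroup with generators $g^i_1,\dots,g^i_{n_i}$ and identity $g^i_0$. For $\alpha=g^i_{j_1}\cdots g^i_{j_p}$ put $e^i_\alpha=e^i_{j_1}\otimes\cdots\otimes e^i_{j_p}$, and $e^i_{g^i_0}=1$. The left and right creation operators on $F^2(H_{n_i})$ are $S_{i,j}e^i_\alpha=e^i_{g^i_j\alpha}$ and $R_{i,j}e^i_\alpha=e^i_{\alpha g^i_j}$; $\mathbf S_{i,j}$ and $\mathbf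 R_{i,j}$ are their ampliations to $\bigotimes_{i=1}^kF^2(H_{n_i})$ (acting on the $i$-th factor, identity on the others). The polyball algebra $\boldsymbol{\mathcal A}_{\mathbf n}$ is the norm closed non-selfadjoint algebra generated by all $\mathbf S_{i,j}$ and the identity. $B(\mathcal E)\otimes_{min}\boldsymbol{\mathcal A}_{\mathbf n}\subset B(\mathcal E\otimes\bigotimes_{i=1}^kF^2(H_{n_i}))$ is the spatial tensor product. A bounded operator $A$ on $\mathcal E\otimes\bigotimes_{i=1}^kF^2(H_{n_i})$ is $k$-multi-Toeplitz if $(I_{\mathcal E}\otimes\mathbf R_{i,s}^* )A(I_{\mathcal E}\otimes\mathbf R_{i,t})=\delta_{st}A$ for all $i\in\{1,\dots,k\}$ and $s,t\in\{1,\dots,n_i\}$. The superscripts $-\mathrm{SOT}$, $-\mathrm{WOT}$ denote closure in the strong, respectively weak, operator topology. *)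

theory Defs
  imports "HOL-Analysis.Analysis"
begin

section \<open>Complex Hilbert spaces\<close>

class complex_vector = real_vector +
  fixes scaleC :: "complex \<Rightarrow> 'a \<Rightarrow> 'a"  (infixr "*\<^sub>C" 75)
  assumes scaleC_add_right: "c *\<^sub>C (x + y) = c *\<^sub>C x + c *\<^sub>C y"
    and scaleC_add_left: "(c + d) *\<^sub>C x = c *\<^sub>C x + d *\<^sub>C x"
    and scaleC_scaleC: "c *\<^sub>C d *\<^sub>C x = (c * d) *\<^sub>C x"
    and scaleR_scaleC: "r *\<^sub>R x = complex_of_real r *\<^sub>C x"

lemma scaleC_one: "1 *\<^sub>C x = (x :: 'a::complex_vector)"
  using scaleR_scaleC[of 1 x] by simp

global_interpretation complex_vector: vector_space "scaleC :: complex \<Rightarrow> 'a \<Rightarrow> 'a::complex_vector"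
  defines cspan = complex_vector.span
    and csubspace = complex_vector.subspace
  by unfold_locales (simp_all add: scaleC_add_right scaleC_add_left scaleC_scaleC scaleC_one)

abbreviation clinear :: "('a::complex_vector \<Rightarrow> 'b::complex_vector) \<Rightarrow> bool"
  where "clinear \<equiv> Vector_Spaces.linear scaleC scaleC"

text \<open>The inner product is linear in the second argument.  Positivity and definiteness are
  consequences of the norm equation.\<close>

class chilbert_space = complex_vector + banach +
  fixes cinner :: "'a \<Rightarrow> 'a \<Rightarrow> complex"
  assumes cinner_commute: "cinner x y = cnj (cinner y x)"
    and cinner_add_right: "cinner x (y + z) = cinner x y + cinner x z"
    and cinner_scaleC_right: "cinner x (c *\<^sub>C y) = c * cinner x y"
    and norm_eq_sqrt_cinner: "norm x = sqrt (Re (cinner x x))"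

lemma norm_scaleC: "norm (c *\<^sub>C x) = cmod c * norm (x :: 'a::chilbert_space)"
proof -
  have "cinner (c *\<^sub>C x) (c *\<^sub>C x) = c * cnj (c * cinner x x)"
    by (metis cinner_commute cinner_scaleC_right)
  also have "\<dots> = complex_of_real ((cmod c)\<^sup>2) * cinner x x"
    using complex_norm_square[of c] cinner_commute[of x x] by simp
  finally show ?thesis
    by (simp add: norm_eq_sqrt_cinner real_sqrt_mult)
qed

definition orthonormal_family :: "'i set \<Rightarrow> ('i \<Rightarrow> 'a::chilbert_space) \<Rightarrow> bool"
  where "orthonormal_family J e \<longleftrightarrow>
    (\<forall>j\<in>J. \<forall>l\<in>J. cinner (e j) (e l) = (if j = l then 1 else 0))"


section \<open>Bounded operators\<close>

text \<open>The library type \<open>'a \<Rightarrow>\<^sub>L 'b\<close> consists of the bounded \<^emph>\<open>real\<close>-linear maps; the operators of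
  the theory are those in \<open>cblinops\<close>, which is closed in all topologies used below.\<close>

definition cblinops :: "('a::chilbert_space \<Rightarrow>\<^sub>L 'b::chilbert_space) set"
  where "cblinops = {A. clinear (blinfun_apply A)}"

instantiation blinfun :: (chilbert_space, chilbert_space) complex_vector
begin

lift_definition scaleC_blinfun :: "complex \<Rightarrow> 'a \<Rightarrow>\<^sub>L 'b \<Rightarrow> 'a \<Rightarrow>\<^sub>L 'b"
  is "\<lambda>c A x. c *\<^sub>C A x"
proof -
  fix c :: complex and A :: "'a \<Rightarrow> 'b"
  assume A: "bounded_linear A"
  then obtain K where K: "\<And>x. norm (A x) \<le> norm x * K"
    using bounded_linear.bounded by blast
  show "bounded_linear (\<lambda>x. c *\<^sub>C A x)"
  proof (rule bounded_linear_intro[where K = "cmod c * K"])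
    show "c *\<^sub>C A (x + y) = c *\<^sub>C A x + c *\<^sub>C A y" for x y
      using A by (simp add: linear_add bounded_linear.linear scaleC_add_right)
    show "c *\<^sub>C A (r *\<^sub>R x) = r *\<^sub>R c *\<^sub>C A x" for r x
      using linear_scale[OF bounded_linear.linear[OF A], of r x]
      by (simp only: scaleR_scaleC scaleC_scaleC mult.commute)
    show "norm (c *\<^sub>C A x) \<le> norm x * (cmod c * K)" for x
      using mult_left_mono[OF K[of x], of "cmod c"] by (simp add: norm_scaleC algebra_simps)
  qed
qed

instance
  by standard (transfer; auto simp: scaleC_add_right scaleC_add_left scaleC_scaleC scaleR_scaleC)+

end

text \<open>The adjoint exists for \<open>A \<in> cblinops\<close> by the Riesz representation theorem.\<close>

definition cadj :: "'a::chilbert_space \<Rightarrow>\<^sub>L 'b::chilbert_space \<Rightarrow> 'b \<Rightarrow>\<^sub>L 'a"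
  where "cadj A = (THE B :: 'b \<Rightarrow>\<^sub>L 'a. \<forall>x y. cinner (B x) y = cinner x (A y))"

text \<open>The strong operator topology is the library's \<^const>\<open>strong_operator_topology\<close>; the weak one
  is the initial topology for the functionals \<open>A \<mapsto> \<langle>y, A x\<rangle>\<close>.\<close>

definition weak_operator_topology :: "('a::chilbert_space \<Rightarrow>\<^sub>L 'b::chilbert_space) topology"
  where "weak_operator_topology =
    pullback_topology UNIV (\<lambda>A (x, y). cinner y (blinfun_apply A x)) euclidean"

definition normclosed_algebra_generated ::
    "('a::chilbert_space \<Rightarrow>\<^sub>L 'a) set \<Rightarrow> ('a \<Rightarrow>\<^sub>L 'a) set"
  where "normclosed_algebra_generated G =
    \<Inter> {M. G \<subseteq> M \<and> closed M \<and> csubspace M \<and> (\<forall>A\<in>M. \<forall>B\<in>M. A o\<^sub>L B \<in> M)}"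


section \<open>Fock spaces and Hilbert tensor products\<close>

text \<open>Tensor products and Fock spaces are determined up to unitary equivalence by the inner
  products of elementary tensors and the density of their span, so they are treated as Hilbert
  spaces equipped with a map producing the elementary tensors.  Multilinearity of these maps
  follows from the inner product formulas.

  In \<open>full_fock H t\<close> the list \<open>[x\<^sub>1, \<dots>, x\<^sub>p]\<close> of vectors of \<open>H\<close> is mapped to
  \<open>x\<^sub>1 \<otimes> \<dots> \<otimes> x\<^sub>p\<close> in the summand of degree \<open>p\<close>, and the empty list to the vacuum vector 1.  The
  spaces \<open>H\<^bsub>n\<^sub>i\<^esub>\<close>, and likewise their Fock spaces, may differ with \<open>i\<close>; both families are therefore
  taken inside ambient Hilbert spaces, and \<open>fock_space H t\<close> is the closed subspace in question.\<close>

definition full_fock :: "'x::chilbert_space set \<Rightarrow> ('x list \<Rightarrow> 'a::chilbert_space) \<Rightarrow> bool"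
  where "full_fock H t \<longleftrightarrow>
    (\<forall>xs\<in>lists H. \<forall>ys\<in>lists H.
       cinner (t xs) (t ys) =
         (if length xs = length ys then \<Prod>p<length xs. cinner (xs ! p) (ys ! p) else 0))"

definition fock_space :: "'x::chilbert_space set \<Rightarrow> ('x list \<Rightarrow> 'a::chilbert_space) \<Rightarrow> 'a set"
  where "fock_space H t = closure (cspan (t ` lists H))"

definition hilbert_tensor_family ::
    "'i set \<Rightarrow> ('i \<Rightarrow> 'a::chilbert_space set) \<Rightarrow> (('i \<Rightarrow> 'a) \<Rightarrow> 'f::chilbert_space) \<Rightarrow> bool"
  where "hilbert_tensor_family I F \<tau> \<longleftrightarrow>
    (\<forall>x\<in>Pi\<^sub>E I F. \<forall>y\<in>Pi\<^sub>E I F. cinner (\<tau> x) (\<tau> y) = (\<Prod>i\<in>I. cinner (x i) (y i))) \<and>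
    closure (cspan (\<tau> ` Pi\<^sub>E I F)) = UNIV"

definition hilbert_tensor ::
    "('e::chilbert_space \<Rightarrow> 'f::chilbert_space \<Rightarrow> 'h::chilbert_space) \<Rightarrow> bool"
  where "hilbert_tensor tens \<longleftrightarrow>
    (\<forall>x \<xi> y \<eta>. cinner (tens x \<xi>) (tens y \<eta>) = cinner x y * cinner \<xi> \<eta>) \<and>
    closure (cspan (range (\<lambda>(x, \<xi>). tens x \<xi>))) = UNIV"

text \<open>\<open>is_tensor_op tens T a G\<close> says \<open>G = T \<otimes> a\<close>; the elementary tensors being total, there is
  exactly one such \<open>G\<close> for \<open>T, a \<in> cblinops\<close>.\<close>

definition is_tensor_op ::
    "('e::chilbert_space \<Rightarrow> 'f::chilbert_space \<Rightarrow> 'h::chilbert_space) \<Rightarrow>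
     ('e \<Rightarrow>\<^sub>L 'e) \<Rightarrow> ('f \<Rightarrow>\<^sub>L 'f) \<Rightarrow> ('h \<Rightarrow>\<^sub>L 'h) \<Rightarrow> bool"
  where "is_tensor_op tens T a G \<longleftrightarrow>
    G \<in> cblinops \<and> (\<forall>x \<xi>. G (tens x \<xi>) = tens (T x) (a \<xi>))"

definition tensor_op ::
    "('e::chilbert_space \<Rightarrow> 'f::chilbert_space \<Rightarrow> 'h::chilbert_space) \<Rightarrow>
     ('e \<Rightarrow>\<^sub>L 'e) \<Rightarrow> ('f \<Rightarrow>\<^sub>L 'f) \<Rightarrow> ('h \<Rightarrow>\<^sub>L 'h)"
  where "tensor_op tens T a = (THE G. is_tensor_op tens T a G)"

definition spatial_tensor ::
    "('e::chilbert_space \<Rightarrow> 'f::chilbert_space \<Rightarrow> 'h::chilbert_space) \<Rightarrow>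
     ('e \<Rightarrow>\<^sub>L 'e) set \<Rightarrow> ('f \<Rightarrow>\<^sub>L 'f) set \<Rightarrow> ('h \<Rightarrow>\<^sub>L 'h) set"
  where "spatial_tensor tens M N = closure (cspan {G. \<exists>T\<in>M. \<exists>a\<in>N. is_tensor_op tens T a G})"


section \<open>The polyball algebra and multi-Toeplitz operators\<close>

text \<open>An element of the free semigroup on \<open>n i\<close> generators is a list of letters in \<open>{1..n i}\<close>;
  a \<open>k\<close>-tuple of such words is made a total function by the empty word outside \<open>{1..k}\<close>.\<close>

definition words :: "nat \<Rightarrow> (nat \<Rightarrow> nat) \<Rightarrow> (nat \<Rightarrow> nat list) set"
  where "words k n =
    {\<alpha>. (\<forall>i\<in>{1..k}. \<alpha> i \<in> lists {1..n i}) \<and> (\<forall>i. i \<notin> {1..k} \<longrightarrow> \<alpha> i = [])}"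

text \<open>The vector \<open>e\<^sup>1\<^bsub>\<alpha> 1\<^esub> \<otimes> \<dots> \<otimes> e\<^sup>k\<^bsub>\<alpha> k\<^esub>\<close>.\<close>

definition fock_basis ::
    "nat \<Rightarrow> (nat \<Rightarrow> nat \<Rightarrow> 'x) \<Rightarrow> (nat \<Rightarrow> 'x list \<Rightarrow> 'a) \<Rightarrow> ((nat \<Rightarrow> 'a) \<Rightarrow> 'f) \<Rightarrow>
     (nat \<Rightarrow> nat list) \<Rightarrow> 'f"
  where "fock_basis k e t \<tau> \<alpha> = \<tau> (\<lambda>i\<in>{1..k}. t i (map (e i) (\<alpha> i)))"

text \<open>Below, \<open>b\<close> stands for \<open>fock_basis k e t \<tau>\<close>.  The ampliations to the \<open>k\<close>-fold tensor product
  are given by their values on this orthonormal basis.\<close>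

definition left_creation ::
    "nat \<Rightarrow> (nat \<Rightarrow> nat) \<Rightarrow> ((nat \<Rightarrow> nat list) \<Rightarrow> 'f::chilbert_space) \<Rightarrow> nat \<Rightarrow> nat \<Rightarrow> 'f \<Rightarrow>\<^sub>L 'f"
  where "left_creation k n b i j =
    (THE A. A \<in> cblinops \<and> (\<forall>\<alpha>\<in>words k n. A (b \<alpha>) = b (\<alpha>(i := j # \<alpha> i))))"

definition right_creation ::
    "nat \<Rightarrow> (nat \<Rightarrow> nat) \<Rightarrow> ((nat \<Rightarrow> nat list) \<Rightarrow> 'f::chilbert_space) \<Rightarrow> nat \<Rightarrow> nat \<Rightarrow> 'f \<Rightarrow>\<^sub>L 'f"
  where "right_creation k n b i j =
    (THE A. A \<in> cblinops \<and> (\<forall>\<alpha>\<in>words k n. A (b \<alpha>) = b (\<alpha>(i := \<alpha> i @ [j]))))"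

definition polyball_algebra ::
    "nat \<Rightarrow> (nat \<Rightarrow> nat) \<Rightarrow> ((nat \<Rightarrow> nat list) \<Rightarrow> 'f::chilbert_space) \<Rightarrow> ('f \<Rightarrow>\<^sub>L 'f) set"
  where "polyball_algebra k n b = normclosed_algebra_generated
    (insert id_blinfun {left_creation k n b i j | i j. i \<in> {1..k} \<and> j \<in> {1..n i}})"

definition multi_toeplitz ::
    "nat \<Rightarrow> (nat \<Rightarrow> nat) \<Rightarrow> ((nat \<Rightarrow> nat list) \<Rightarrow> 'f::chilbert_space) \<Rightarrow>
     ('e::chilbert_space \<Rightarrow> 'f \<Rightarrow> 'h::chilbert_space) \<Rightarrow> ('h \<Rightarrow>\<^sub>L 'h) set"
  where "multi_toeplitz k n b tens =
    {A \<in> cblinops. \<forall>i\<in>{1..k}. \<forall>s\<in>{1..n i}. \<forall>t\<in>{1..n i}.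
       tensor_op tens id_blinfun (cadj (right_creation k n b i s)) o\<^sub>L A o\<^sub>L
       tensor_op tens id_blinfun (right_creation k n b i t) = (if s = t then A else 0)}"

end

theory Submission
  imports Defs
begin

text \<open>Operators in the spatial tensor product commute with the right creation operators, which are
  isometries with orthogonal ranges, so every \<open>f\<^sup>* g\<close> is multi-Toeplitz; and the defining equations
  are weakly closed.

  Conversely, the matrix coefficients of a multi-Toeplitz operator \<open>A\<close> in the word basis depend only
  on the pair of words obtained by deleting common last letters.  Hence for each difference of
  multi-lengths the corresponding diagonal of \<open>A\<close> is a finite combination of operators
  \<open>(I \<otimes> S\<^sub>\<alpha>)\<^sup>* (T \<otimes> S\<^sub>\<beta>)\<close>.  The Fejer means of these diagonals are Schur products of \<open>A\<close> with positive
  semidefinite matrices of unit diagonal, so their norms are at most the norm of \<open>A\<close>; on a basis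
  vector they act as \<open>A\<close> followed by diagonal contractions tending strongly to the identity, so they
  converge strongly to \<open>A\<close>.\<close>

text \<open>Partial sums over the diagonals of \<open>A\<close> are in general not controlled by the
  norm of \<open>A\<close>, just as for Fourier series, so means that do not increase the norm are
  needed. Instead of averaging over the k-torus, the weights are counted: each tuple of words gets a
  cube of side N in N^k with lowest corner at its multi-length, and the weight of a pair is the
  number of points common to the two cubes, divided by N^k. This is the product of the numbers
  max(0, 1 - |p_i|/N), where p is the difference of multi-lengths. As an overlap count it is a Gram
  matrix, so the norm bound is a finite Cauchy-Schwarz argument; and it vanishes once some |p_i|
  reaches N, so each mean is a finite sum.

  For k > 1 a reduced pair may keep letters on the left in some coordinates and on the right in
  others, which is why products of adjoints with analytic operators occur and not only sums of the
  two.

  The uniform norm bound reduces strong convergence to word vectors. The limits are limits of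
  sequences, and one sequence serves both topologies.\<close>

section \<open>Inner products\<close>

text \<open>With the scalars as a Hilbert space, the tensor product of Fock spaces is a Hilbert sum
  of copies of a Hilbert space, and shares its operator construction with the vector-valued
  space.\<close>

instantiation complex :: chilbert_space
begin

definition scaleC_complex :: "complex \<Rightarrow> complex \<Rightarrow> complex"
  where "scaleC_complex c x = c * x"

definition cinner_complex :: "complex \<Rightarrow> complex \<Rightarrow> complex"
  where "cinner_complex x y = cnj x * y"

instance
  by standard
    (auto simp: scaleC_complex_def cinner_complex_def algebra_simps scaleR_conv_of_real cmod_def
      power2_eq_square)

end

lemma cinner_add_left: "cinner (x + y) z = cinner x z + cinner y (z::'a::chilbert_space)"
  by (metis cinner_add_right cinner_commute complex_cnj_add)

lemma cinner_scaleC_left: "cinner (c *\<^sub>C x) y = cnj c * cinner x (y::'a::chilbert_space)"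
  by (metis cinner_commute cinner_scaleC_right complex_cnj_mult)

lemma additive_cinner_right: "Modules.additive (cinner (x::'a::chilbert_space))"
  by (simp add: Modules.additive_def cinner_add_right)

lemma additive_cinner_left: "Modules.additive (\<lambda>x. cinner x (y::'a::chilbert_space))"
  by (simp add: Modules.additive_def cinner_add_left)

lemmas cinner_zero_right [simp] = Modules.additive.zero[OF additive_cinner_right]
  and cinner_zero_left [simp] = Modules.additive.zero[OF additive_cinner_left]
  and cinner_minus_right = Modules.additive.minus[OF additive_cinner_right]
  and cinner_diff_right = Modules.additive.diff[OF additive_cinner_right]
  and cinner_diff_left = Modules.additive.diff[OF additive_cinner_left]
  and cinner_sum_right = Modules.additive.sum[OF additive_cinner_right]
  and cinner_sum_left = Modules.additive.sum[OF additive_cinner_left]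

lemma cinner_scaleR_right: "cinner x (r *\<^sub>R y) = of_real r * cinner x (y::'a::chilbert_space)"
  by (simp add: scaleR_scaleC cinner_scaleC_right)

lemma cinner_scaleR_left: "cinner (r *\<^sub>R x) y = of_real r * cinner x (y::'a::chilbert_space)"
  by (simp add: scaleR_scaleC cinner_scaleC_left)

text \<open>Positivity is hidden in the norm equation: the real \<open>sqrt\<close> is negative at
  negative arguments, so a nonnegative norm forces \<open>Re (cinner x x)\<close> to be
  nonnegative.\<close>

lemma cinner_self: "cinner x x = of_real ((norm (x::'a::chilbert_space))\<^sup>2)"
proof -
  have "Im (cinner x x) = 0"
    using cinner_commute[of x x] by (metis cnj.simps(2) neg_equal_zero)
  moreover have "0 \<le> Re (cinner x x)"
    using norm_eq_sqrt_cinner[of x] norm_ge_zero[of x] by (metis real_sqrt_ge_0_iff)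
  then have "(norm x)\<^sup>2 = Re (cinner x x)"
    by (simp add: norm_eq_sqrt_cinner)
  ultimately show ?thesis
    by (simp add: complex_eq_iff)
qed

lemma norm_add_sq:
  "(norm (x + y))\<^sup>2 = (norm x)\<^sup>2 + 2 * Re (cinner x y) + (norm (y::'a::chilbert_space))\<^sup>2"
proof -
  have "cinner (x + y) (x + y) = cinner x x + (cinner x y + cnj (cinner x y)) + cinner y y"
    by (metis (no_types, lifting) add.assoc cinner_add_left cinner_add_right cinner_commute)
  from arg_cong[OF this, of Re] show ?thesis
    by (simp add: cinner_self)
qed

lemma norm_cinner_le: "cmod (cinner x y) \<le> norm x * norm (y::'a::chilbert_space)"
proof (cases "x = 0")
  case False
  define c where "c = cinner x y"
  define n where "n = (norm x)\<^sup>2"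
  have n: "n > 0" using False by (simp add: n_def)
  \<comment> \<open>This vector is \<open>n\<close> times the component of \<open>y\<close>
    orthogonal to \<open>x\<close>; the factor avoids a division by \<open>n\<close>.\<close>
  have "cinner (n *\<^sub>R y - c *\<^sub>C x) (n *\<^sub>R y - c *\<^sub>C x)
    = of_real n * of_real n * cinner y y - of_real n * c * cinner y x
      - cnj c * of_real n * cinner x y + cnj c * c * cinner x x"
    by (simp add: cinner_diff_right cinner_diff_left cinner_scaleR_right cinner_scaleR_left
        cinner_scaleC_left cinner_scaleC_right algebra_simps)
  also have "cinner y x = cnj c" by (metis c_def cinner_commute)
  also have "cinner x y = c" by (simp add: c_def)
  also have "cinner x x = of_real n" by (simp add: cinner_self n_def)
  also have "of_real n * of_real n * cinner y y - of_real n * c * cnj c - cnj c * of_real n * c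
      + cnj c * c * of_real n = of_real (n * (n * (norm y)\<^sup>2 - (cmod c)\<^sup>2))"
    by (simp add: cinner_self complex_norm_square[unfolded of_real_power] algebra_simps)
  finally have "of_real ((norm (n *\<^sub>R y - c *\<^sub>C x))\<^sup>2) = (of_real (n * (n * (norm y)\<^sup>2 - (cmod c)\<^sup>2)) :: complex)"
    by (simp add: cinner_self)
  then have "n * (n * (norm y)\<^sup>2 - (cmod c)\<^sup>2) \<ge> 0"
    by (metis of_real_eq_iff zero_le_power2)
  with n have "(cmod c)\<^sup>2 \<le> n * (norm y)\<^sup>2"
    by (simp add: zero_le_mult_iff)
  then have "(cmod c)\<^sup>2 \<le> (norm x * norm y)\<^sup>2"
    by (simp add: n_def power_mult_distrib)
  then show ?thesis
    unfolding c_def by (rule power2_le_imp_le) simp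
qed simp

lemma bounded_linear_cinner_right: "bounded_linear (cinner (x::'a::chilbert_space))"
  by (rule bounded_linear_intro[where K="norm x"])
    (auto simp: cinner_add_right cinner_scaleR_right scaleR_conv_of_real mult.commute
      intro: order_trans[OF norm_cinner_le])

lemma bounded_linear_cinner_left: "bounded_linear (\<lambda>x. cinner x (y::'a::chilbert_space))"
  by (rule bounded_linear_intro[where K="norm y"])
    (auto simp: cinner_add_left cinner_scaleR_left scaleR_conv_of_real norm_cinner_le)

lemma bounded_linear_scaleC: "bounded_linear (\<lambda>x::'a::chilbert_space. c *\<^sub>C x)"
  by (rule bounded_linear_intro[where K="cmod c"])
    (auto simp: scaleC_add_right norm_scaleC scaleR_scaleC scaleC_scaleC mult.commute)

lemma cinner_ext: "x = y" if "\<And>z. cinner z x = cinner z (y::'a::chilbert_space)"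
proof -
  have "cinner (x - y) (x - y) = 0"
    by (simp add: cinner_diff_right that)
  then show ?thesis by (simp add: cinner_self)
qed

lemma cinner_ext_left: "x = y" if "\<And>z. cinner x z = cinner (y::'a::chilbert_space) z"
proof (rule cinner_ext)
  show "cinner z x = cinner z y" for z
    using that[of z] cinner_commute[of z x] cinner_commute[of z y] by simp
qed

lemma closed_csubspace_cinner_right:
  "closed {x. cinner z x = cinner z' (x::'a::chilbert_space)}"
  "csubspace {x. cinner z x = cinner z' (x::'a::chilbert_space)}"
  by (auto intro!: closed_Collect_eq bounded_linear.continuous_on[OF bounded_linear_cinner_right]
      continuous_intros simp: complex_vector.subspace_def cinner_add_right cinner_scaleC_right)

text \<open>Density packaged as an induction rule: identities of continuous linear maps are later
  checked on word vectors and elementary tensors only.\<close>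

lemma total_induct [consumes 1, case_names base closed subspace]:
  assumes "closure (cspan B) = (UNIV::'a::chilbert_space set)"
    and "\<And>x. x \<in> B \<Longrightarrow> P x" "closed {x. P x}" "csubspace {x. P x}"
  shows "P (x::'a)"
proof -
  have "cspan B \<subseteq> {x. P x}"
    using assms by (intro complex_vector.span_minimal) auto
  then have "closure (cspan B) \<subseteq> {x. P x}"
    using assms(3) by (intro closure_minimal)
  then show ?thesis using assms(1) by auto
qed

lemma cinner_ext_total:
  assumes "closure (cspan B) = (UNIV::'a::chilbert_space set)"
    and "\<And>z. z \<in> B \<Longrightarrow> cinner z x = cinner z y"
  shows "x = y"
proof (rule cinner_ext)
  have "cinner x z = cinner y z" for z
    using assms(1)
  proof (induction z rule: total_induct)
    case (base z)
    then show ?case using assms(2) by (metis cinner_commute)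
  qed (rule closed_csubspace_cinner_right)+
  then show "cinner z x = cinner z y" for z
    by (metis cinner_commute)
qed

section \<open>The Riesz representation theorem and adjoints\<close>

text \<open>The representing vector minimizes \<open>\<parallel>x\<parallel>\<^sup>2 - 2 Re (\<phi> x)\<close>; minimizing sequences are Cauchy by the
  parallelogram law.\<close>

lemma riesz_representation:
  fixes \<phi> :: "'a::chilbert_space \<Rightarrow> complex"
  assumes bl: "bounded_linear \<phi>" and sc: "\<And>c x. \<phi> (c *\<^sub>C x) = c * \<phi> x"
  obtains z where "\<And>x. \<phi> x = cinner z x"
proof -
  interpret bounded_linear \<phi> by fact
  define J where "J x = (norm x)\<^sup>2 - 2 * Re (\<phi> x)" for x
  obtain K where K: "\<And>x. norm (\<phi> x) \<le> norm x * K" "K \<ge> 0"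
    using nonneg_bounded by blast
  have below: "J x \<ge> - K\<^sup>2" for x
  proof -
    have "Re (\<phi> x) \<le> norm x * K"
      using K(1)[of x] complex_Re_le_cmod[of "\<phi> x"] by linarith
    moreover have "0 \<le> (norm x - K)\<^sup>2" by simp
    ultimately show ?thesis by (simp add: J_def power2_diff)
  qed
  define m where "m = Inf (range J)"
  have bdd: "bdd_below (range J)" using below by (auto intro!: bdd_belowI)
  have m: "m \<le> J x" for x
    unfolding m_def using bdd by (intro cInf_lower) auto
  have "\<exists>x. J x < m + 1 / real (Suc n)" for n
  proof -
    have "Inf (range J) < m + 1 / real (Suc n)" by (simp add: m_def)
    then show ?thesis using cInf_lessD[of "range J"] by blast
  qed
  then obtain X where X: "\<And>n. J (X n) < m + 1 / real (Suc n)" by metis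
  have par: "(norm (x - y))\<^sup>2 \<le> 2 * (J x - m) + 2 * (J y - m)" for x y
  proof -
    have "J ((1/2) *\<^sub>R (x + y)) = (norm (x + y))\<^sup>2 / 4 - Re (\<phi> x) - Re (\<phi> y)"
    proof -
      have "norm ((1/2) *\<^sub>R (x + y)) = norm (x + y) / 2"
        by simp
      moreover have "Re (\<phi> ((1/2) *\<^sub>R (x + y))) = (Re (\<phi> x) + Re (\<phi> y)) / 2"
        unfolding scaleR add by simp
      ultimately show ?thesis
        unfolding J_def by (simp add: power_divide)
    qed
    moreover have "(norm (x - y))\<^sup>2 = 2 * (norm x)\<^sup>2 + 2 * (norm y)\<^sup>2 - (norm (x + y))\<^sup>2"
      using norm_add_sq[of x y] norm_add_sq[of x "-y"] by (simp add: cinner_minus_right)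
    ultimately show ?thesis
      using m[of "(1/2) *\<^sub>R (x + y)"] by (simp add: J_def)
  qed
  have "Cauchy X"
  proof (rule CauchyI)
    fix e :: real assume e: "e > 0"
    obtain N where N: "4 / e\<^sup>2 < real (Suc N)"
      by (meson lessI less_trans of_nat_less_iff reals_Archimedean2)
    then have N': "4 / real (Suc N) < e\<^sup>2"
      using e by (simp add: field_simps)
    have "norm (X p - X q) < e" if "p \<ge> N" "q \<ge> N" for p q
    proof -
      have *: "J (X p) < m + 1 / real (Suc N)" if "p \<ge> N" for p
        using X[of p] that by (smt (verit) frac_le of_nat_0_less_iff of_nat_mono Suc_le_mono zero_less_Suc)
      have "(norm (X p - X q))\<^sup>2 < e\<^sup>2"
        using par[of "X p" "X q"] *[OF that(1)] *[OF that(2)] N' by simp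
      then show ?thesis by (rule power2_less_imp_less) (use e in simp)
    qed
    then show "\<exists>M. \<forall>p\<ge>M. \<forall>q\<ge>M. norm (X p - X q) < e" by blast
  qed
  then obtain z where z: "X \<longlonglongrightarrow> z"
    using Cauchy_convergent_iff convergent_def by blast
  have "(\<lambda>n. J (X n)) \<longlonglongrightarrow> J z"
    unfolding J_def using z by (intro tendsto_intros tendsto_Re tendsto)
  moreover have "(\<lambda>n. m + 1 / real (Suc n)) \<longlonglongrightarrow> m + 0"
    by (intro tendsto_intros LIMSEQ_Suc[OF lim_1_over_n])
  ultimately have Jz: "J z \<le> m"
    using X by (intro LIMSEQ_le[of _ "J z" _ m]) (auto intro: less_imp_le)
  have Re0: "Re (cinner z h - \<phi> h) = 0" for h
  proof (rule ccontr)
    define d where "d = Re (cinner z h - \<phi> h)"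
    assume "Re (cinner z h - \<phi> h) \<noteq> 0"
    then have d: "d \<noteq> 0" by (simp add: d_def)
    \<comment> \<open>The choice of \<open>s\<close> below minimises
      \<open>2 * s * d + s\<^sup>2 * B\<close>; the added 1 keeps \<open>B\<close> positive when
      \<open>h = 0\<close>.\<close>
    define B where "B = (norm h)\<^sup>2 + 1"
    have B: "B > 0" by (simp add: B_def add_nonneg_pos)
    define s where "s = - d / B"
    have "J (z + s *\<^sub>R h) = J z + 2 * s * d + s\<^sup>2 * (norm h)\<^sup>2"
      by (simp add: J_def norm_add_sq cinner_scaleR_right add scaleR d_def power_mult_distrib algebra_simps)
    also have "\<dots> \<le> J z + 2 * s * d + s\<^sup>2 * B"
      by (simp add: B_def algebra_simps)
    also have "\<dots> = J z - d\<^sup>2 / B"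
      using B by (simp add: s_def power2_eq_square field_simps)
    also have "\<dots> < J z" using d B by simp
    finally show False using m[of "z + s *\<^sub>R h"] Jz by simp
  qed
  have "\<phi> h = cinner z h" for h
  proof -
    \<comment> \<open>Complex linearity turns the identity of real parts at
      \<open>\<i> *\<^sub>C h\<close> into that of imaginary parts at \<open>h\<close>.\<close>
    have "Im (cinner z h - \<phi> h) = - Re (cinner z (\<i> *\<^sub>C h) - \<phi> (\<i> *\<^sub>C h))"
      by (simp add: sc cinner_scaleC_right)
    with Re0[of "\<i> *\<^sub>C h"] Re0[of h] show ?thesis by (simp add: complex_eq_iff)
  qed
  then show thesis by (rule that)
qed

lemma cblinops_iff: "A \<in> cblinops \<longleftrightarrow> (\<forall>c x. A (c *\<^sub>C x) = c *\<^sub>C A x)"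
proof -
  show ?thesis
    unfolding cblinops_def mem_Collect_eq Vector_Spaces.linear_def module_hom_def module_hom_axioms_def
    by (auto simp: complex_vector.vector_space_axioms blinfun.add_right complex_vector.module_axioms)
qed

lemma cblinopsD: "A \<in> cblinops \<Longrightarrow> A (c *\<^sub>C x) = c *\<^sub>C A x"
  by (simp add: cblinops_iff)

lemma cadj_unique:
  assumes "\<And>x y. cinner (blinfun_apply B x) y = cinner x (blinfun_apply A y)"
  shows "cadj A = B"
  unfolding cadj_def
proof (rule the_equality)
  fix C assume C: "\<forall>x y. cinner (blinfun_apply C x) y = cinner x (A y)"
  show "C = B"
    by (intro blinfun_eqI, rule cinner_ext_left) (simp add: assms C)
qed (use assms in blast)

lemma cinner_cadj_left:
  fixes A :: "'a::chilbert_space \<Rightarrow>\<^sub>L 'b::chilbert_space"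
  assumes "A \<in> cblinops"
  shows "cinner (cadj A x) y = cinner x (A y)"
proof -
  have "\<exists>z. \<forall>y. cinner x (A y) = cinner z y" for x
    by (rule riesz_representation[of "\<lambda>y. cinner x (A y)"])
      (auto intro: bounded_linear_compose[OF bounded_linear_cinner_right] blinfun.bounded_linear_right
        simp: cblinopsD[OF assms] cinner_scaleC_right)
  then obtain B where B: "\<And>x y. cinner (B x) y = cinner x (A y)" by metis
  have B': "cinner y (B x) = cinner (A y) x" for x y
    by (simp add: cinner_commute[of y] B cinner_commute[of "A y"])
  have "bounded_linear B"
  proof (rule bounded_linear_intro[where K="norm A"])
    show "B (x + y) = B x + B y" for x y
      by (rule cinner_ext) (simp add: B' cinner_add_right)
    show "B (r *\<^sub>R x) = r *\<^sub>R B x" for r x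
      by (rule cinner_ext) (simp add: B' cinner_scaleR_right)
    show "norm (B x) \<le> norm x * norm A" for x
    proof (cases "B x = 0")
      case False
      have "(norm (B x))\<^sup>2 = cmod (cinner x (A (B x)))"
        by (simp add: B[symmetric] cinner_self norm_power)
      also have "\<dots> \<le> norm x * (norm A * norm (B x))"
        by (meson norm_cinner_le norm_blinfun mult_left_mono norm_ge_zero order_trans)
      finally show ?thesis using False by (simp add: power2_eq_square)
    qed simp
  qed
  then have "cadj A = Blinfun B"
    by (intro cadj_unique) (simp add: bounded_linear_Blinfun_apply B)
  then show ?thesis using \<open>bounded_linear B\<close> by (simp add: bounded_linear_Blinfun_apply B)
qed

lemma cinner_cadj_right: "A \<in> cblinops \<Longrightarrow> cinner y (cadj A x) = cinner (A y) x"
  by (simp add: cinner_commute[of y] cinner_cadj_left cinner_commute[of "A y"])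

lemma cadj_in_cblinops: "A \<in> cblinops \<Longrightarrow> cadj A \<in> cblinops"
  unfolding cblinops_iff[of "cadj A"]
  by (intro allI, rule cinner_ext) (simp add: cinner_cadj_right cinner_scaleC_right)

lemma csubspace_cblinops: "csubspace cblinops"
  by (auto simp: complex_vector.subspace_def cblinops_iff blinfun.add_left scaleC_add_right
      scaleC_blinfun.rep_eq scaleC_scaleC mult.commute)

lemma closed_cblinops: "closed (cblinops :: ('a::chilbert_space \<Rightarrow>\<^sub>L 'b::chilbert_space) set)"
proof -
  have eq: "cblinops = (\<Inter>c. \<Inter>x::'a. {A::'a \<Rightarrow>\<^sub>L 'b. blinfun_apply A (c *\<^sub>C x) = c *\<^sub>C blinfun_apply A x})"
    by (auto simp: cblinops_iff)
  have "closed {A::'a \<Rightarrow>\<^sub>L 'b. blinfun_apply A (c *\<^sub>C x) = c *\<^sub>C blinfun_apply A x}" for c x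
  proof (rule closed_Collect_eq)
    show "continuous_on UNIV (\<lambda>A::'a \<Rightarrow>\<^sub>L 'b. blinfun_apply A (c *\<^sub>C x))"
      by (intro continuous_intros)
    have "continuous_on UNIV (\<lambda>A::'a \<Rightarrow>\<^sub>L 'b. blinfun_apply A x)"
      by (intro continuous_intros)
    then show "continuous_on UNIV (\<lambda>A::'a \<Rightarrow>\<^sub>L 'b. c *\<^sub>C blinfun_apply A x)"
      by (rule bounded_linear.continuous_on[OF bounded_linear_scaleC])
  qed
  then show ?thesis unfolding eq by (intro closed_INT ballI)
qed

lemma cblinops_compose: "A \<in> cblinops \<Longrightarrow> B \<in> cblinops \<Longrightarrow> A o\<^sub>L B \<in> cblinops"
  by (simp add: cblinops_iff)

lemma id_in_cblinops: "id_blinfun \<in> cblinops"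
  by (simp add: cblinops_iff)

lemma cblinops_eq_total:
  assumes "closure (cspan B) = UNIV" "A \<in> cblinops" "A' \<in> cblinops"
    and "\<And>x. x \<in> B \<Longrightarrow> blinfun_apply A x = blinfun_apply A' x"
  shows "A = A'"
proof (rule blinfun_eqI)
  show "A x = A' x" for x
    using assms(1)
  proof (induction x rule: total_induct)
    case closed
    show ?case by (intro closed_Collect_eq continuous_intros)
  next
    case subspace
    show ?case using assms(2,3)
      by (auto simp: complex_vector.subspace_def blinfun.add_right cblinops_iff)
  qed (rule assms)
qed

section \<open>Extension of densely defined operators\<close>

text \<open>Working with a relation spares a separate proof that values are well defined: the bound,
  applied to differences, makes the closure of \<open>D\<close> single-valued, and completeness
  makes it total.\<close>

lemma graph_extension:
  fixes D :: "('a::chilbert_space \<times> 'b::chilbert_space) set"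
  assumes add: "\<And>x y x' y'. (x, y) \<in> D \<Longrightarrow> (x', y') \<in> D \<Longrightarrow> (x + x', y + y') \<in> D"
    and scale: "\<And>c x y. (x, y) \<in> D \<Longrightarrow> (c *\<^sub>C x, c *\<^sub>C y) \<in> D"
    and dense: "closure (fst ` D) = UNIV"
    and bound: "\<And>x y. (x, y) \<in> D \<Longrightarrow> norm y \<le> K * norm x" and K: "K \<ge> 0"
  obtains A where "A \<in> cblinops" "\<And>x y. (x, y) \<in> D \<Longrightarrow> blinfun_apply A x = y" "norm A \<le> K"
proof -
  define \<Gamma> where "\<Gamma> = closure D"
  have \<Gamma>: "(x, y) \<in> \<Gamma> \<longleftrightarrow> (\<exists>X Y. (\<forall>n. (X n, Y n) \<in> D) \<and> X \<longlonglongrightarrow> x \<and> Y \<longlonglongrightarrow> y)" for x y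
  proof
    assume "(x, y) \<in> \<Gamma>"
    then obtain Z where Z: "\<And>n. Z n \<in> D" "Z \<longlonglongrightarrow> (x, y)"
      unfolding \<Gamma>_def closure_sequential by blast
    then show "\<exists>X Y. (\<forall>n. (X n, Y n) \<in> D) \<and> X \<longlonglongrightarrow> x \<and> Y \<longlonglongrightarrow> y"
      using tendsto_fst[OF Z(2)] tendsto_snd[OF Z(2)]
      by (intro exI[of _ "\<lambda>n. fst (Z n)"] exI[of _ "\<lambda>n. snd (Z n)"]) auto
  next
    assume "\<exists>X Y. (\<forall>n. (X n, Y n) \<in> D) \<and> X \<longlonglongrightarrow> x \<and> Y \<longlonglongrightarrow> y"
    then obtain X Y where "\<And>n. (X n, Y n) \<in> D" "X \<longlonglongrightarrow> x" "Y \<longlonglongrightarrow> y" by blast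
    then show "(x, y) \<in> \<Gamma>"
      unfolding \<Gamma>_def closure_sequential by (intro exI[of _ "\<lambda>n. (X n, Y n)"]) (auto intro: tendsto_Pair)
  qed
  have \<Gamma>_add: "(x + x', y + y') \<in> \<Gamma>" if "(x, y) \<in> \<Gamma>" "(x', y') \<in> \<Gamma>" for x y x' y'
  proof -
    obtain X Y X' Y' where "\<And>n. (X n, Y n) \<in> D" "X \<longlonglongrightarrow> x" "Y \<longlonglongrightarrow> y"
      "\<And>n. (X' n, Y' n) \<in> D" "X' \<longlonglongrightarrow> x'" "Y' \<longlonglongrightarrow> y'"
      using \<open>(x, y) \<in> \<Gamma>\<close> \<open>(x', y') \<in> \<Gamma>\<close> unfolding \<Gamma> by blast
    then show ?thesis
      unfolding \<Gamma> by (intro exI[of _ "\<lambda>n. X n + X' n"] exI[of _ "\<lambda>n. Y n + Y' n"])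
        (auto intro: add tendsto_add)
  qed
  have \<Gamma>_scale: "(c *\<^sub>C x, c *\<^sub>C y) \<in> \<Gamma>" if "(x, y) \<in> \<Gamma>" for c x y
  proof -
    obtain X Y where "\<And>n. (X n, Y n) \<in> D" "X \<longlonglongrightarrow> x" "Y \<longlonglongrightarrow> y"
      using \<open>(x, y) \<in> \<Gamma>\<close> unfolding \<Gamma> by blast
    then show ?thesis
      unfolding \<Gamma> by (intro exI[of _ "\<lambda>n. c *\<^sub>C X n"] exI[of _ "\<lambda>n. c *\<^sub>C Y n"])
        (auto intro: scale bounded_linear.tendsto[OF bounded_linear_scaleC])
  qed
  have \<Gamma>_diff: "(x - x', y - y') \<in> \<Gamma>" if "(x, y) \<in> \<Gamma>" "(x', y') \<in> \<Gamma>" for x y x' y'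
  proof -
    have "(- 1) *\<^sub>C z = - z" for z :: "'z::chilbert_space"
      using scaleR_scaleC[of "-1" z] by simp
    then show ?thesis using \<Gamma>_add[OF that(1) \<Gamma>_scale[OF that(2), of "-1"]] by simp
  qed
  have diff: "(x - x', y - y') \<in> D" if "(x, y) \<in> D" "(x', y') \<in> D" for x y x' y'
  proof -
    have "(- 1) *\<^sub>C z = - z" for z :: "'z::chilbert_space"
      using scaleR_scaleC[of "-1" z] by simp
    then show ?thesis using add[OF that(1) scale[OF that(2), of "-1"]] by simp
  qed
  have \<Gamma>_bound: "norm y \<le> K * norm x" if "(x, y) \<in> \<Gamma>" for x y
  proof -
    have "\<Gamma> \<subseteq> {p. norm (snd p) \<le> K * norm (fst p)}"
      unfolding \<Gamma>_def
      by (intro closure_minimal closed_Collect_le continuous_intros) (auto dest: bound)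
    then show ?thesis using that by auto
  qed
  have ex: "\<exists>y. (x, y) \<in> \<Gamma>" for x
  proof -
    obtain X where X: "\<And>n. X n \<in> fst ` D" "X \<longlonglongrightarrow> x"
      using dense closure_sequential[of x "fst ` D"] by auto
    then have "\<forall>n. \<exists>y. (X n, y) \<in> D" by force
    then obtain Y where Y: "\<And>n. (X n, Y n) \<in> D" by metis
    have "Cauchy Y"
    proof (rule CauchyI)
      fix e :: real assume e: "e > 0"
      have "Cauchy X" using X(2) LIMSEQ_imp_Cauchy by blast
      \<comment> \<open>Dividing by \<open>K + 1\<close> also covers \<open>K = 0\<close>.\<close>
      then obtain M where M: "\<And>p q. p \<ge> M \<Longrightarrow> q \<ge> M \<Longrightarrow> norm (X p - X q) < e / (K + 1)"
        using e K by (meson CauchyD divide_pos_pos add_nonneg_pos zero_less_one)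
      have "norm (Y p - Y q) < e" if "p \<ge> M" "q \<ge> M" for p q
      proof -
        have "norm (Y p - Y q) \<le> K * norm (X p - X q)"
          by (rule bound[OF diff[OF Y Y]])
        also have "\<dots> \<le> K * (e / (K + 1))"
          using M[OF that] K by (intro mult_left_mono) auto
        also have "\<dots> < e" using e K by (simp add: field_simps)
        finally show ?thesis .
      qed
      then show "\<exists>M. \<forall>p\<ge>M. \<forall>q\<ge>M. norm (Y p - Y q) < e" by blast
    qed
    then obtain y where "Y \<longlonglongrightarrow> y"
      using Cauchy_convergent_iff convergent_def by blast
    then show ?thesis unfolding \<Gamma> using X(2) Y by blast
  qed
  have unique: "y = y'" if "(x, y) \<in> \<Gamma>" "(x, y') \<in> \<Gamma>" for x y y'
    using \<Gamma>_bound[OF \<Gamma>_diff[OF that]] by simp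
  obtain A where A: "\<And>x. (x, A x) \<in> \<Gamma>" using ex by metis
  have "bounded_linear A"
  proof (rule bounded_linear_intro[where K=K])
    show "A (x + y) = A x + A y" for x y
      using unique[OF A \<Gamma>_add[OF A A]] .
    show "A (r *\<^sub>R x) = r *\<^sub>R A x" for r x
      using unique[OF A \<Gamma>_scale[OF A, of "of_real r" x, folded scaleR_scaleC]] .
    show "norm (A x) \<le> norm x * K" for x
      using \<Gamma>_bound[OF A] by (simp add: mult.commute)
  qed
  then have app: "blinfun_apply (Blinfun A) = A"
    by (rule bounded_linear_Blinfun_apply)
  show thesis
  proof
    show "Blinfun A \<in> cblinops"
      unfolding cblinops_iff app using unique[OF A \<Gamma>_scale[OF A]] by blast
    show "blinfun_apply (Blinfun A) x = y" if "(x, y) \<in> D" for x y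
      unfolding app using that closure_subset[of D] by (intro unique[OF A]) (auto simp: \<Gamma>_def)
    show "norm (Blinfun A) \<le> K"
      using \<Gamma>_bound[OF A] K by (intro norm_blinfun_bound) (auto simp: app)
  qed
qed

text \<open>The uniform bound makes the subspace of vectors on which the sequence tends to 0 closed,
  by an epsilon/2 argument. Strong convergence to other limits is obtained by applying this to
  differences.\<close>

lemma null_sequence_total:
  fixes A :: "nat \<Rightarrow> 'a::chilbert_space \<Rightarrow>\<^sub>L 'b::chilbert_space"
  assumes B: "closure (cspan B) = UNIV" and A: "\<And>N. A N \<in> cblinops" and K: "\<And>N. norm (A N) \<le> K"
    and lim: "\<And>x. x \<in> B \<Longrightarrow> (\<lambda>N. A N x) \<longlonglongrightarrow> 0"
  shows "(\<lambda>N. A N x) \<longlonglongrightarrow> 0"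
  using B
proof (induction x rule: total_induct)
  case closed
  let ?S = "{x. (\<lambda>N. A N x) \<longlonglongrightarrow> 0}"
  have K0: "K \<ge> 0" using K[of 0] norm_ge_zero order_trans by blast
  have "x \<in> ?S" if x: "x \<in> closure ?S" for x
  proof -
    have "(\<lambda>N. A N x) \<longlonglongrightarrow> 0"
    proof (rule LIMSEQ_I)
      fix e :: real assume e: "e > 0"
      then have "e / (2 * (K + 1)) > 0" using K0 by simp
      then obtain y where y: "y \<in> ?S" "dist y x < e / (2 * (K + 1))"
        using x unfolding closure_approachable by blast
      then obtain M where M: "\<And>N. N \<ge> M \<Longrightarrow> norm (A N y) < e / 2"
        using LIMSEQ_D[of "\<lambda>N. A N y" 0 "e/2"] e by auto
      have "norm (A N x - 0) < e" if "N \<ge> M" for N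
      proof -
        have "norm (A N x) = norm (A N y + A N (x - y))"
          by (simp add: blinfun.diff_right)
        also have "\<dots> \<le> norm (A N y) + norm (A N (x - y))"
          by (rule norm_triangle_ineq)
        also have "norm (A N (x - y)) \<le> norm (A N) * norm (x - y)"
          by (rule norm_blinfun)
        also have "\<dots> \<le> K * (e / (2 * (K + 1)))"
          using y(2) K0 K by (intro mult_mono) (auto simp: dist_norm norm_minus_commute)
        also have "\<dots> \<le> e / 2" using e K0 by (simp add: field_simps)
        finally show ?thesis using M[OF that] by simp
      qed
      then show "\<exists>no. \<forall>n\<ge>no. norm (A n x - 0) < e" by blast
    qed
    then show ?thesis by simp
  qed
  then show ?case using closure_subset[of ?S] by (metis closure_closed closed_closure subsetI subset_antisym)
next
  case subspace
  have "(\<lambda>N. c *\<^sub>C A N x) \<longlonglongrightarrow> 0" if "(\<lambda>N. A N x) \<longlonglongrightarrow> 0" for c x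
    using bounded_linear.tendsto[OF bounded_linear_scaleC that, of c] by simp
  then show ?case
    by (auto simp: complex_vector.subspace_def blinfun.add_right cblinopsD[OF A] intro: tendsto_add_zero)
qed (rule lim)

section \<open>Hilbert sums of copies of a Hilbert space\<close>

text \<open>Brings two finite sums to a common index set by adding zero coefficients. The general
  \<open>g\<close> serves both for vectors and for their images under an operator.\<close>

lemma sum_Un_extend_by_zero:
  assumes "finite F" "finite F'"
    and add: "\<And>\<gamma> u v. \<gamma> \<in> F \<union> F' \<Longrightarrow> g \<gamma> (u + v) = g \<gamma> u + (g \<gamma> v :: 'z::comm_monoid_add)"
    and zero: "\<And>\<gamma>. \<gamma> \<in> F \<union> F' \<Longrightarrow> g \<gamma> 0 = 0"
  shows "(\<Sum>\<gamma>\<in>F. g \<gamma> (s \<gamma>)) + (\<Sum>\<gamma>\<in>F'. g \<gamma> (s' \<gamma>)) =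
    (\<Sum>\<gamma>\<in>F \<union> F'. g \<gamma> ((if \<gamma> \<in> F then s \<gamma> else 0) + (if \<gamma> \<in> F' then s' \<gamma> else (0::'y::monoid_add))))"
proof -
  have "(\<Sum>\<gamma>\<in>F. g \<gamma> (s \<gamma>)) = (\<Sum>\<gamma>\<in>F \<union> F'. g \<gamma> (if \<gamma> \<in> F then s \<gamma> else 0))"
    using assms by (intro sum.mono_neutral_cong_left) auto
  moreover have "(\<Sum>\<gamma>\<in>F'. g \<gamma> (s' \<gamma>)) = (\<Sum>\<gamma>\<in>F \<union> F'. g \<gamma> (if \<gamma> \<in> F' then s' \<gamma> else 0))"
    using assms by (intro sum.mono_neutral_cong_left) auto
  ultimately show ?thesis by (simp only: add sum.distrib[symmetric] cong: sum.cong)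
qed

text \<open>Orthogonal isometric copies of one Hilbert space with dense span. Linearity of each
  \<open>V \<gamma>\<close> is derived: vectors with equal inner products against all
  \<open>V \<delta> u\<close> coincide.\<close>

locale hilbert_sum =
  fixes W :: "'w set" and V :: "'w \<Rightarrow> 'e::chilbert_space \<Rightarrow> 'h::chilbert_space"
  assumes cinner_V: "\<gamma> \<in> W \<Longrightarrow> \<delta> \<in> W \<Longrightarrow> cinner (V \<gamma> u) (V \<delta> v) = (if \<gamma> = \<delta> then cinner u v else 0)"
    and total_V: "closure (cspan {V \<gamma> u | \<gamma> u. \<gamma> \<in> W}) = UNIV"
begin

lemma V_ext: "x = y" if "\<And>\<gamma> u. \<gamma> \<in> W \<Longrightarrow> cinner (V \<gamma> u) x = cinner (V \<gamma> u) y"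
  using total_V by (rule cinner_ext_total) (use that in blast)

lemma V_add: "\<gamma> \<in> W \<Longrightarrow> V \<gamma> (u + v) = V \<gamma> u + V \<gamma> v"
  by (rule V_ext) (simp add: cinner_add_right cinner_V)

lemma V_scaleC: "\<gamma> \<in> W \<Longrightarrow> V \<gamma> (c *\<^sub>C u) = c *\<^sub>C V \<gamma> u"
  by (rule V_ext) (simp add: cinner_scaleC_right cinner_V)

lemma V_zero: "\<gamma> \<in> W \<Longrightarrow> V \<gamma> 0 = 0"
  by (rule V_ext) (simp add: cinner_V)

lemma norm_V: "\<gamma> \<in> W \<Longrightarrow> norm (V \<gamma> u) = norm u"
  by (simp add: norm_eq_sqrt_cinner cinner_V)

lemma bounded_linear_V: "\<gamma> \<in> W \<Longrightarrow> bounded_linear (V \<gamma>)"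
  by (rule bounded_linear_intro[where K=1]) (auto simp: V_add V_scaleC scaleR_scaleC norm_V)

lemma norm_sum_V:
  assumes "finite F" "F \<subseteq> W"
  shows "(norm (\<Sum>\<gamma>\<in>F. V \<gamma> (s \<gamma>)))\<^sup>2 = (\<Sum>\<gamma>\<in>F. (norm (s \<gamma>))\<^sup>2)"
proof -
  have "cinner (\<Sum>\<gamma>\<in>F. V \<gamma> (s \<gamma>)) (\<Sum>\<gamma>\<in>F. V \<gamma> (s \<gamma>)) = (\<Sum>\<delta>\<in>F. \<Sum>\<gamma>\<in>F. cinner (V \<gamma> (s \<gamma>)) (V \<delta> (s \<delta>)))"
    by (simp only: cinner_sum_right cinner_sum_left)
  also have "\<dots> = (\<Sum>\<delta>\<in>F. \<Sum>\<gamma>\<in>F. if \<gamma> = \<delta> then cinner (s \<gamma>) (s \<gamma>) else 0)"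
    using assms by (intro sum.cong refl) (auto simp: cinner_V subset_iff)
  also have "\<dots> = of_real (\<Sum>\<gamma>\<in>F. (norm (s \<gamma>))\<^sup>2)"
    using assms by (simp add: cinner_self)
  finally show ?thesis unfolding cinner_self of_real_eq_iff .
qed

text \<open>Each index occurs once in such a sum, which makes \<open>norm_sum_V\<close> applicable;
  coefficients at equal indices merge because \<open>V \<gamma>\<close> is additive.\<close>

lemma dense_sum_V: "closure {\<Sum>\<gamma>\<in>F. V \<gamma> (s \<gamma>) | F s. finite F \<and> F \<subseteq> W} = UNIV" (is "closure ?S = _")
proof -
  have "csubspace ?S"
    unfolding complex_vector.subspace_def
  proof (intro conjI ballI allI)
    show "0 \<in> ?S" by (intro CollectI exI[of _ "{}"]) auto
    fix x y assume "x \<in> ?S" "y \<in> ?S"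
    then obtain F s F' s' where F: "finite F" "F \<subseteq> W" "x = (\<Sum>\<gamma>\<in>F. V \<gamma> (s \<gamma>))"
      "finite F'" "F' \<subseteq> W" "y = (\<Sum>\<gamma>\<in>F'. V \<gamma> (s' \<gamma>))" by blast
    then have "x + y = (\<Sum>\<gamma>\<in>F \<union> F'. V \<gamma> ((if \<gamma> \<in> F then s \<gamma> else 0) + (if \<gamma> \<in> F' then s' \<gamma> else 0)))"
      by (subst sum_Un_extend_by_zero[symmetric]) (auto intro: V_add V_zero)
    with F show "x + y \<in> ?S"
      by (intro CollectI exI[of _ "F \<union> F'"] exI conjI) auto
  next
    fix c x assume "x \<in> ?S"
    then obtain F s where F: "finite F" "F \<subseteq> W" "x = (\<Sum>\<gamma>\<in>F. V \<gamma> (s \<gamma>))" by blast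
    then have "c *\<^sub>C x = (\<Sum>\<gamma>\<in>F. V \<gamma> (c *\<^sub>C s \<gamma>))"
      by (auto simp: complex_vector.scale_sum_right V_scaleC subset_iff intro!: sum.cong)
    with F show "c *\<^sub>C x \<in> ?S"
      by (intro CollectI exI[of _ F] exI conjI) auto
  qed
  moreover have "{V \<gamma> u | \<gamma> u. \<gamma> \<in> W} \<subseteq> ?S"
  proof clarify
    fix \<gamma> u assume "\<gamma> \<in> W"
    then show "\<exists>F s. V \<gamma> u = (\<Sum>\<gamma>\<in>F. V \<gamma> (s \<gamma>)) \<and> finite F \<and> F \<subseteq> W"
      by (intro exI[of _ "{\<gamma>}"] exI[of _ "\<lambda>_. u"]) auto
  qed
  ultimately have "cspan {V \<gamma> u | \<gamma> u. \<gamma> \<in> W} \<subseteq> ?S"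
    by (intro complex_vector.span_minimal)
  from closure_mono[OF this] show ?thesis using total_V by auto
qed

text \<open>An injective \<open>\<sigma>\<close> sends distinct summands to distinct summands, so
  images stay orthogonal and Pythagoras gives the bound \<open>K\<close>. This one construction
  yields creation operators, their tensor products with operators on the coefficient space, and
  diagonal operators.\<close>

lemma operator_exists:
  assumes \<sigma>: "inj_on \<sigma> W" "\<sigma> ` W \<subseteq> W"
    and T: "\<And>\<gamma>. \<gamma> \<in> W \<Longrightarrow> T \<gamma> \<in> cblinops" "\<And>\<gamma>. \<gamma> \<in> W \<Longrightarrow> norm (T \<gamma>) \<le> K" and K: "K \<ge> 0"
  obtains G where "G \<in> cblinops" "\<And>\<gamma> u. \<gamma> \<in> W \<Longrightarrow> blinfun_apply G (V \<gamma> u) = V (\<sigma> \<gamma>) (T \<gamma> u)" "norm G \<le> K"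
proof -
  define D where "D = {(\<Sum>\<gamma>\<in>F. V \<gamma> (s \<gamma>), \<Sum>\<gamma>\<in>F. V (\<sigma> \<gamma>) (T \<gamma> (s \<gamma>))) | F s. finite F \<and> F \<subseteq> W}"
  have \<sigma>W: "\<gamma> \<in> W \<Longrightarrow> \<sigma> \<gamma> \<in> W" for \<gamma> using \<sigma> by auto
  obtain A where A: "A \<in> cblinops" "\<And>x y. (x, y) \<in> D \<Longrightarrow> blinfun_apply A x = y" "norm A \<le> K"
  proof (rule graph_extension[where D=D and K=K])
    fix x y x' y' assume "(x, y) \<in> D" "(x', y') \<in> D"
    then obtain F s F' s' where F: "finite F" "F \<subseteq> W" "x = (\<Sum>\<gamma>\<in>F. V \<gamma> (s \<gamma>))" "y = (\<Sum>\<gamma>\<in>F. V (\<sigma> \<gamma>) (T \<gamma> (s \<gamma>)))"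
      "finite F'" "F' \<subseteq> W" "x' = (\<Sum>\<gamma>\<in>F'. V \<gamma> (s' \<gamma>))" "y' = (\<Sum>\<gamma>\<in>F'. V (\<sigma> \<gamma>) (T \<gamma> (s' \<gamma>)))"
      unfolding D_def by blast
    let ?s = "\<lambda>\<gamma>. (if \<gamma> \<in> F then s \<gamma> else 0) + (if \<gamma> \<in> F' then s' \<gamma> else 0)"
    have "x + x' = (\<Sum>\<gamma>\<in>F \<union> F'. V \<gamma> (?s \<gamma>))"
      using F by (subst sum_Un_extend_by_zero[symmetric]) (auto intro: V_add V_zero)
    moreover have "y + y' = (\<Sum>\<gamma>\<in>F \<union> F'. V (\<sigma> \<gamma>) (T \<gamma> (?s \<gamma>)))"
      unfolding F(4,8)
      using F by (intro sum_Un_extend_by_zero[where g="\<lambda>\<gamma> u. V (\<sigma> \<gamma>) (T \<gamma> u)"])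
        (auto simp: subset_iff blinfun.add_right V_add \<sigma>W V_zero)
    ultimately show "(x + x', y + y') \<in> D"
      unfolding D_def using F by (intro CollectI exI[of _ "F \<union> F'"] exI[of _ ?s]) auto
  next
    fix c x y assume "(x, y) \<in> D"
    then obtain F s where F: "finite F" "F \<subseteq> W" "x = (\<Sum>\<gamma>\<in>F. V \<gamma> (s \<gamma>))" "y = (\<Sum>\<gamma>\<in>F. V (\<sigma> \<gamma>) (T \<gamma> (s \<gamma>)))"
      unfolding D_def by blast
    then have "c *\<^sub>C x = (\<Sum>\<gamma>\<in>F. V \<gamma> (c *\<^sub>C s \<gamma>))" "c *\<^sub>C y = (\<Sum>\<gamma>\<in>F. V (\<sigma> \<gamma>) (T \<gamma> (c *\<^sub>C s \<gamma>)))"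
      by (auto simp: complex_vector.scale_sum_right V_scaleC subset_iff \<sigma>W cblinopsD[OF T(1)] intro!: sum.cong)
    with F show "(c *\<^sub>C x, c *\<^sub>C y) \<in> D"
      unfolding D_def by (intro CollectI exI[of _ F] exI[of _ "\<lambda>\<gamma>. c *\<^sub>C s \<gamma>"]) auto
  next
    have "fst ` D = {\<Sum>\<gamma>\<in>F. V \<gamma> (s \<gamma>) | F s. finite F \<and> F \<subseteq> W}"
      unfolding D_def by (auto simp: image_def)
    then show "closure (fst ` D) = UNIV" using dense_sum_V by simp
  next
    fix x y assume "(x, y) \<in> D"
    then obtain F s where F: "finite F" "F \<subseteq> W" "x = (\<Sum>\<gamma>\<in>F. V \<gamma> (s \<gamma>))" "y = (\<Sum>\<gamma>\<in>F. V (\<sigma> \<gamma>) (T \<gamma> (s \<gamma>)))"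
      unfolding D_def by blast
    have inj: "inj_on \<sigma> F" using \<sigma>(1) F(2) by (rule inj_on_subset)
    \<comment> \<open>Reindexing along \<open>\<sigma>\<close> puts the image into the form required
      by \<open>norm_sum_V\<close>.\<close>
    have "y = (\<Sum>\<delta>\<in>\<sigma> ` F. V \<delta> ((\<lambda>\<delta>. T (the_inv_into F \<sigma> \<delta>) (s (the_inv_into F \<sigma> \<delta>))) \<delta>))"
      unfolding F(4) by (subst sum.reindex[OF inj]) (auto intro!: sum.cong simp: the_inv_into_f_f[OF inj])
    moreover have "finite (\<sigma> ` F)" "\<sigma> ` F \<subseteq> W" using F \<sigma>W by auto
    ultimately have "(norm y)\<^sup>2 = (\<Sum>\<delta>\<in>\<sigma> ` F. (norm (T (the_inv_into F \<sigma> \<delta>) (s (the_inv_into F \<sigma> \<delta>))))\<^sup>2)"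
      by (simp only: norm_sum_V)
    also have "\<dots> = (\<Sum>\<gamma>\<in>F. (norm (T \<gamma> (s \<gamma>)))\<^sup>2)"
      by (subst sum.reindex[OF inj]) (auto intro!: sum.cong simp: the_inv_into_f_f[OF inj])
    also have "\<dots> \<le> (\<Sum>\<gamma>\<in>F. (K * norm (s \<gamma>))\<^sup>2)"
    proof (intro sum_mono power_mono)
      fix \<gamma> assume "\<gamma> \<in> F"
      then show "norm (T \<gamma> (s \<gamma>)) \<le> K * norm (s \<gamma>)"
        using norm_blinfun[of "T \<gamma>" "s \<gamma>"] T(2)[of \<gamma>] F(2) mult_right_mono[of "norm (T \<gamma>)" K "norm (s \<gamma>)"]
        by auto
    qed auto
    also have "\<dots> = (K * norm x)\<^sup>2"
      using F by (simp add: norm_sum_V power_mult_distrib sum_distrib_left)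
    finally show "norm y \<le> K * norm x"
      by (rule power2_le_imp_le) (use K in simp)
  qed (rule K, blast)
  show thesis
  proof
    show "blinfun_apply A (V \<gamma> u) = V (\<sigma> \<gamma>) (T \<gamma> u)" if "\<gamma> \<in> W" for \<gamma> u
    proof (rule A(2))
      show "(V \<gamma> u, V (\<sigma> \<gamma>) (T \<gamma> u)) \<in> D"
        unfolding D_def using that by (intro CollectI exI[of _ "{\<gamma>}"] exI[of _ "\<lambda>_. u"]) auto
    qed
  qed (fact A)+
qed

lemma operator_eqI:
  assumes "A \<in> cblinops" "B \<in> cblinops"
    and "\<And>\<gamma> u. \<gamma> \<in> W \<Longrightarrow> blinfun_apply A (V \<gamma> u) = blinfun_apply B (V \<gamma> u)"
  shows "A = B"
  using total_V assms(1,2) by (rule cblinops_eq_total) (use assms(3) in blast)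

text \<open>\<open>G\<close> is the Schur product of \<open>A\<close> with the matrix \<open>card (C \<delta> \<inter> C \<gamma>) / M\<close>, which is positive
  semidefinite with unit diagonal.\<close>

lemma norm_schur_product_le:
  fixes C :: "'w \<Rightarrow> 'c set"
  assumes GA: "G \<in> cblinops" "A \<in> cblinops"
    and C: "\<And>\<gamma>. \<gamma> \<in> W \<Longrightarrow> finite (C \<gamma>)" "\<And>\<gamma>. \<gamma> \<in> W \<Longrightarrow> card (C \<gamma>) = M" and M: "M > 0"
    and entries: "\<And>\<gamma> \<delta> u v. \<gamma> \<in> W \<Longrightarrow> \<delta> \<in> W \<Longrightarrow>
      of_nat M * cinner (V \<delta> v) (blinfun_apply G (V \<gamma> u)) = of_nat (card (C \<delta> \<inter> C \<gamma>)) * cinner (V \<delta> v) (blinfun_apply A (V \<gamma> u))"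
  shows "norm G \<le> norm A"
proof -
  let ?S = "{\<Sum>\<gamma>\<in>F. V \<gamma> (s \<gamma>) | F s. finite F \<and> F \<subseteq> W}"
  have main: "cmod (cinner y (G x)) \<le> norm A * norm x * norm y" if "x \<in> ?S" "y \<in> ?S" for x y
  proof -
    obtain F s F' s' where F: "finite F" "F \<subseteq> W" "x = (\<Sum>\<gamma>\<in>F. V \<gamma> (s \<gamma>))"
      "finite F'" "F' \<subseteq> W" "y = (\<Sum>\<gamma>\<in>F'. V \<gamma> (s' \<gamma>))" using \<open>x \<in> ?S\<close> \<open>y \<in> ?S\<close> by blast
    define U where "U = (\<Union>\<gamma>\<in>F \<union> F'. C \<gamma>)"
    have finU: "finite U" using F C(1) by (auto simp: U_def)
    define cut where "cut c f = (\<lambda>\<gamma>. if c \<in> C \<gamma> then f \<gamma> else (0::'e))" for c f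
    \<comment> \<open>\<open>X c\<close> and \<open>Y c\<close> keep the components of
      \<open>x\<close> and \<open>y\<close> whose set contains \<open>c\<close>. An entry of
      \<open>G\<close> times \<open>M\<close> is the entry of \<open>A\<close> counted once for
      every \<open>c\<close> common to both sets.\<close>
    define X where "X c = (\<Sum>\<gamma>\<in>F. V \<gamma> (cut c s \<gamma>))" for c
    define Y where "Y c = (\<Sum>\<gamma>\<in>F'. V \<gamma> (cut c s' \<gamma>))" for c
    \<comment> \<open>Every component survives for exactly \<open>M\<close> values of
      \<open>c\<close>.\<close>
    have sq: "(\<Sum>c\<in>U. (norm (\<Sum>\<gamma>\<in>E. V \<gamma> (cut c f \<gamma>)))\<^sup>2) = real M * (norm (\<Sum>\<gamma>\<in>E. V \<gamma> (f \<gamma>)))\<^sup>2"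
      if E: "E \<subseteq> F \<union> F'" for E f
    proof -
      have E': "finite E" "E \<subseteq> W" using F E by (auto intro: finite_subset)
      have "(\<Sum>c\<in>U. (norm (\<Sum>\<gamma>\<in>E. V \<gamma> (cut c f \<gamma>)))\<^sup>2) = (\<Sum>c\<in>U. \<Sum>\<gamma>\<in>E. (norm (cut c f \<gamma>))\<^sup>2)"
        using E' by (simp add: norm_sum_V)
      also have "\<dots> = (\<Sum>\<gamma>\<in>E. \<Sum>c\<in>U. if c \<in> C \<gamma> then (norm (f \<gamma>))\<^sup>2 else 0)"
        by (subst sum.swap) (auto simp: cut_def intro!: sum.cong)
      also have "\<dots> = (\<Sum>\<gamma>\<in>E. real M * (norm (f \<gamma>))\<^sup>2)"
      proof (intro sum.cong refl)
        fix \<gamma> assume "\<gamma> \<in> E"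
        then have "U \<inter> C \<gamma> = C \<gamma>" "\<gamma> \<in> W" using E E' by (auto simp: U_def)
        then show "(\<Sum>c\<in>U. if c \<in> C \<gamma> then (norm (f \<gamma>))\<^sup>2 else 0) = real M * (norm (f \<gamma>))\<^sup>2"
          using finU C(2) by (simp flip: sum.inter_restrict)
      qed
      also have "\<dots> = real M * (norm (\<Sum>\<gamma>\<in>E. V \<gamma> (f \<gamma>)))\<^sup>2"
        using E' by (simp add: norm_sum_V sum_distrib_left)
      finally show ?thesis .
    qed
    have "of_nat M * cinner y (G x) = (\<Sum>\<gamma>\<in>F. \<Sum>\<delta>\<in>F'. of_nat M * cinner (V \<delta> (s' \<delta>)) (G (V \<gamma> (s \<gamma>))))"
      unfolding F(3,6) by (simp only: blinfun.sum_right cinner_sum_right cinner_sum_left sum_distrib_left)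
    also have "\<dots> = (\<Sum>\<gamma>\<in>F. \<Sum>\<delta>\<in>F'. \<Sum>c\<in>U. cinner (V \<delta> (cut c s' \<delta>)) (A (V \<gamma> (cut c s \<gamma>))))"
    proof (intro sum.cong refl)
      fix \<gamma> \<delta> assume *: "\<gamma> \<in> F" "\<delta> \<in> F'"
      then have W: "\<gamma> \<in> W" "\<delta> \<in> W" using F by auto
      have U: "U \<inter> (C \<delta> \<inter> C \<gamma>) = C \<delta> \<inter> C \<gamma>" using * by (auto simp: U_def)
      have "(\<Sum>c\<in>U. cinner (V \<delta> (cut c s' \<delta>)) (A (V \<gamma> (cut c s \<gamma>))))
        = (\<Sum>c\<in>U. if c \<in> C \<delta> \<inter> C \<gamma> then cinner (V \<delta> (s' \<delta>)) (A (V \<gamma> (s \<gamma>))) else 0)"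
        using W by (intro sum.cong refl) (auto simp: cut_def V_zero)
      also have "\<dots> = of_nat (card (C \<delta> \<inter> C \<gamma>)) * cinner (V \<delta> (s' \<delta>)) (A (V \<gamma> (s \<gamma>)))"
        using finU by (subst sum.inter_restrict[symmetric]) (simp_all add: U)
      finally show "of_nat M * cinner (V \<delta> (s' \<delta>)) (G (V \<gamma> (s \<gamma>)))
        = (\<Sum>c\<in>U. cinner (V \<delta> (cut c s' \<delta>)) (A (V \<gamma> (cut c s \<gamma>))))"
        using entries[OF W] by simp
    qed
    also have "\<dots> = (\<Sum>c\<in>U. \<Sum>\<gamma>\<in>F. \<Sum>\<delta>\<in>F'. cinner (V \<delta> (cut c s' \<delta>)) (A (V \<gamma> (cut c s \<gamma>))))"
      by (subst sum.swap[of _ _ U], intro sum.cong refl, rule sum.swap)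
    also have "\<dots> = (\<Sum>c\<in>U. cinner (Y c) (A (X c)))"
      unfolding X_def Y_def by (simp only: blinfun.sum_right cinner_sum_right cinner_sum_left)
    finally have "real M * cmod (cinner y (G x)) = cmod (\<Sum>c\<in>U. cinner (Y c) (A (X c)))"
      by (metis norm_mult norm_of_nat)
    \<comment> \<open>The absolute values match the form of \<open>L2_set_mult_ineq\<close>, the
      Cauchy-Schwarz inequality over \<open>c\<close>.\<close>
    also have "\<dots> \<le> (\<Sum>c\<in>U. norm A * (\<bar>norm (X c)\<bar> * \<bar>norm (Y c)\<bar>))"
    proof (intro sum_norm_le)
      fix c
      have "cmod (cinner (Y c) (A (X c))) \<le> norm (Y c) * norm (A (X c))" by (rule norm_cinner_le)
      also have "\<dots> \<le> norm (Y c) * (norm A * norm (X c))"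
        by (intro mult_left_mono norm_blinfun) auto
      finally show "cmod (cinner (Y c) (A (X c))) \<le> norm A * (\<bar>norm (X c)\<bar> * \<bar>norm (Y c)\<bar>)"
        by (simp add: mult_ac)
    qed
    also have "\<dots> \<le> norm A * (L2_set (\<lambda>c. norm (X c)) U * L2_set (\<lambda>c. norm (Y c)) U)"
      unfolding sum_distrib_left[symmetric] by (intro mult_left_mono L2_set_mult_ineq) auto
    also have "L2_set (\<lambda>c. norm (X c)) U = sqrt (real M) * norm x"
      unfolding L2_set_def X_def by (subst sq) (auto simp: F(3) real_sqrt_mult)
    also have "L2_set (\<lambda>c. norm (Y c)) U = sqrt (real M) * norm y"
      unfolding L2_set_def Y_def by (subst sq) (auto simp: F(6) real_sqrt_mult)
    also have "norm A * (sqrt (real M) * norm x * (sqrt (real M) * norm y)) = real M * (norm A * norm x * norm y)"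
      by simp
    finally show ?thesis using M by simp
  qed
  \<comment> \<open>\<open>y\<close> has to range over the whole space before the choice
    \<open>y = G x\<close>, since \<open>G x\<close> need not be a finite sum.\<close>
  have le: "cmod (cinner y (G x)) \<le> norm A * norm x * norm y" if "x \<in> ?S" for x y
  proof -
    have "closure ?S \<subseteq> {y. cmod (cinner y (G x)) \<le> norm A * norm x * norm y}"
      using main[OF that]
      by (intro closure_minimal closed_Collect_le continuous_intros
          bounded_linear.continuous_on[OF bounded_linear_cinner_left]) auto
    then show ?thesis unfolding dense_sum_V by auto
  qed
  have "norm (G x) \<le> norm A * norm x" if "x \<in> ?S" for x
  proof (cases "G x = 0")
    case False
    have "norm (G x) * norm (G x) \<le> norm A * norm x * norm (G x)"
      using le[OF that, of "G x"] by (simp add: cinner_self norm_power power2_eq_square norm_mult)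
    then show ?thesis using False by simp
  qed simp
  then have "closure ?S \<subseteq> {x. norm (G x) \<le> norm A * norm x}"
    by (intro closure_minimal closed_Collect_le continuous_intros) auto
  then show ?thesis
    unfolding dense_sum_V by (intro norm_blinfun_bound) auto
qed

end

section \<open>The orthonormal basis of the tensor product of Fock spaces\<close>

lemma prod_add_one_factor:
  fixes f g h :: "'i \<Rightarrow> 'c::comm_semiring_1"
  assumes "finite I" "m \<in> I" "h m = f m + g m"
    and "\<And>i. i \<in> I \<Longrightarrow> i \<noteq> m \<Longrightarrow> f i = h i" "\<And>i. i \<in> I \<Longrightarrow> i \<noteq> m \<Longrightarrow> g i = h i"
  shows "prod h I = prod f I + prod g I"
proof -
  have "prod f (I - {m}) = prod h (I - {m})" "prod g (I - {m}) = prod h (I - {m})"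
    using assms(4,5) by (auto intro: prod.cong)
  then show ?thesis
    using assms(1-3) by (simp add: prod.remove distrib_right)
qed

lemma prod_mult_one_factor:
  fixes f h :: "'i \<Rightarrow> 'c::comm_semiring_1"
  assumes "finite I" "m \<in> I" "h m = c * f m" "\<And>i. i \<in> I \<Longrightarrow> i \<noteq> m \<Longrightarrow> f i = h i"
  shows "prod h I = c * prod f I"
proof -
  have "prod f (I - {m}) = prod h (I - {m})"
    using assms(4) by (auto intro: prod.cong)
  then show ?thesis
    using assms(1-3) by (simp add: prod.remove mult.assoc)
qed

text \<open>The Fock spaces lie in an ambient space where their tensors need not be total, so
  testing against \<open>Y\<close> separates only vectors of \<open>cspan Y\<close>: there the
  difference is orthogonal to itself.\<close>

lemma cspan_cinner_ext:
  assumes "p \<in> cspan Y" "q \<in> cspan Y" and eq: "\<And>y. y \<in> Y \<Longrightarrow> cinner y p = cinner y (q::'a::chilbert_space)"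
  shows "p = q"
proof -
  have "Y \<subseteq> {y. cinner p y = cinner q y}"
  proof
    fix y assume "y \<in> Y"
    then show "y \<in> {y. cinner p y = cinner q y}"
      using eq[of y] cinner_commute[of p y] cinner_commute[of q y] by simp
  qed
  then have "cspan Y \<subseteq> {y. cinner p y = cinner q y}"
    by (intro complex_vector.span_minimal closed_csubspace_cinner_right)
  then have "cinner p (p - q) = cinner q (p - q)"
    using complex_vector.span_diff[OF assms(1,2)] by auto
  then have "cinner (p - q) (p - q) = 0"
    by (simp add: cinner_diff_left)
  then show ?thesis by (simp add: cinner_self)
qed

lemma csubspace_closure:
  assumes "csubspace (S::'a::chilbert_space set)"
  shows "csubspace (closure S)"
  unfolding complex_vector.subspace_def
proof (intro conjI ballI allI)
  show "0 \<in> closure S"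
    using assms closure_subset by (auto simp: complex_vector.subspace_def)
  fix x y assume "x \<in> closure S" "y \<in> closure S"
  then obtain X Y where "\<And>n. X n \<in> S" "X \<longlonglongrightarrow> x" "\<And>n. Y n \<in> S" "Y \<longlonglongrightarrow> y"
    unfolding closure_sequential by blast
  then show "x + y \<in> closure S"
    using assms unfolding closure_sequential complex_vector.subspace_def
    by (intro exI[of _ "\<lambda>n. X n + Y n"]) (auto intro: tendsto_add)
next
  fix c x assume "x \<in> closure S"
  then obtain X where "\<And>n. X n \<in> S" "X \<longlonglongrightarrow> x"
    unfolding closure_sequential by blast
  then show "c *\<^sub>C x \<in> closure S"
    using assms unfolding closure_sequential complex_vector.subspace_def
    by (intro exI[of _ "\<lambda>n. c *\<^sub>C X n"]) (auto intro: bounded_linear.tendsto[OF bounded_linear_scaleC])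
qed

text \<open>\<open>full_fock\<close> prescribes only inner products. Testing against elementary
  tensors of the same degree, a single factor of the product splits; in unequal degrees both sides
  are 0.\<close>

lemma full_fock_add:
  assumes t: "full_fock H t" and H: "csubspace H"
    and xs: "xs \<in> lists H" "ys \<in> lists H" and uv: "u \<in> H" "v \<in> H"
  shows "t (xs @ (u + v) # ys) = t (xs @ u # ys) + t (xs @ v # ys)"
proof (rule cspan_cinner_ext)
  have uv': "u + v \<in> H" using H uv by (auto simp: complex_vector.subspace_def)
  show "t (xs @ (u + v) # ys) \<in> cspan (t ` lists H)"
    using xs uv' by (intro complex_vector.span_base imageI) auto
  show "t (xs @ u # ys) + t (xs @ v # ys) \<in> cspan (t ` lists H)"
    using xs uv by (intro complex_vector.span_add complex_vector.span_base imageI) auto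
  fix z assume "z \<in> t ` lists H"
  then obtain zs where zs: "z = t zs" "zs \<in> lists H" by auto
  show "cinner z (t (xs @ (u + v) # ys)) = cinner z (t (xs @ u # ys) + t (xs @ v # ys))"
  proof (cases "length zs = length xs + Suc (length ys)")
    case True
    have "(\<Prod>p<length zs. cinner (zs ! p) ((xs @ (u + v) # ys) ! p)) =
      (\<Prod>p<length zs. cinner (zs ! p) ((xs @ u # ys) ! p)) + (\<Prod>p<length zs. cinner (zs ! p) ((xs @ v # ys) ! p))"
      using True by (intro prod_add_one_factor[of _ "length xs"]) (auto simp: nth_append cinner_add_right nth_Cons')
    then show ?thesis
      using t xs uv uv' zs True by (simp add: full_fock_def cinner_add_right)
  next
    case False
    then show ?thesis
      using t xs uv uv' zs by (simp add: full_fock_def cinner_add_right)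
  qed
qed

lemma full_fock_scaleC:
  assumes t: "full_fock H t" and H: "csubspace H"
    and xs: "xs \<in> lists H" "ys \<in> lists H" and u: "u \<in> H"
  shows "t (xs @ (c *\<^sub>C u) # ys) = c *\<^sub>C t (xs @ u # ys)"
proof (rule cspan_cinner_ext)
  have cu: "c *\<^sub>C u \<in> H" using H u by (auto simp: complex_vector.subspace_def)
  show "t (xs @ (c *\<^sub>C u) # ys) \<in> cspan (t ` lists H)"
    using xs cu by (intro complex_vector.span_base imageI) auto
  show "c *\<^sub>C t (xs @ u # ys) \<in> cspan (t ` lists H)"
    using xs u by (intro complex_vector.span_scale complex_vector.span_base imageI) auto
  fix z assume "z \<in> t ` lists H"
  then obtain zs where zs: "z = t zs" "zs \<in> lists H" by auto
  show "cinner z (t (xs @ (c *\<^sub>C u) # ys)) = cinner z (c *\<^sub>C t (xs @ u # ys))"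
  proof (cases "length zs = length xs + Suc (length ys)")
    case True
    have "(\<Prod>p<length zs. cinner (zs ! p) ((xs @ (c *\<^sub>C u) # ys) ! p)) =
      c * (\<Prod>p<length zs. cinner (zs ! p) ((xs @ u # ys) ! p))"
      using True by (intro prod_mult_one_factor[of _ "length xs"]) (auto simp: nth_append cinner_scaleC_right nth_Cons')
    then show ?thesis
      using t xs u cu zs True by (simp add: full_fock_def cinner_scaleC_right)
  next
    case False
    then show ?thesis
      using t xs u cu zs by (simp add: full_fock_def cinner_scaleC_right)
  qed
qed

text \<open>The prefix \<open>\<alpha>\<close> is already expanded in basis vectors. The vectors
  admissible as next factor form a subspace containing the basis, so the expansion proceeds from
  left to right.\<close>

lemma full_fock_in_span:
  assumes t: "full_fock (cspan (e ` J)) t" and xs: "xs \<in> lists (cspan (e ` J))" and \<alpha>: "\<alpha> \<in> lists J"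
  shows "t (map e \<alpha> @ xs) \<in> cspan ((\<lambda>\<alpha>. t (map e \<alpha>)) ` lists J)"
  using xs \<alpha>
proof (induction xs arbitrary: \<alpha> rule: list.induct)
  case Nil
  then show ?case by (auto intro: complex_vector.span_base)
next
  case (Cons u xs)
  let ?H = "cspan (e ` J)" and ?L = "cspan ((\<lambda>\<alpha>. t (map e \<alpha>)) ` lists J)"
  have H: "csubspace ?H" by (rule complex_vector.subspace_span)
  have e\<alpha>: "map e \<alpha> \<in> lists ?H"
    using Cons.prems by (auto intro!: complex_vector.span_base)
  have xs: "xs \<in> lists ?H" using Cons.prems by auto
  have "?H \<subseteq> {u \<in> ?H. t (map e \<alpha> @ u # xs) \<in> ?L}"
  proof (rule complex_vector.span_minimal)
    show "e ` J \<subseteq> {u \<in> ?H. t (map e \<alpha> @ u # xs) \<in> ?L}"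
    proof clarify
      fix j assume j: "j \<in> J"
      then have "t (map e (\<alpha> @ [j]) @ xs) \<in> ?L" using Cons by (intro Cons.IH) auto
      then show "e j \<in> ?H \<and> t (map e \<alpha> @ e j # xs) \<in> ?L"
        using j by (auto intro: complex_vector.span_base)
    qed
    have "t (map e \<alpha> @ 0 # xs) = 0"
      using full_fock_scaleC[OF t H e\<alpha> xs complex_vector.span_zero, of 0] by simp
    then show "csubspace {u \<in> ?H. t (map e \<alpha> @ u # xs) \<in> ?L}"
      using xs e\<alpha>
      by (auto simp: complex_vector.subspace_def full_fock_add[OF t H] full_fock_scaleC[OF t H]
          intro: complex_vector.span_zero complex_vector.span_add complex_vector.span_scale)
  qed
  then show ?case using Cons.prems by auto
qed

lemma fock_space_eq:
  assumes "full_fock (cspan (e ` J)) t"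
  shows "fock_space (cspan (e ` J)) t = closure (cspan ((\<lambda>\<alpha>. t (map e \<alpha>)) ` lists J))"
proof -
  have "cspan (t ` lists (cspan (e ` J))) = cspan ((\<lambda>\<alpha>. t (map e \<alpha>)) ` lists J)"
  proof (rule complex_vector.span_eq[THEN iffD2], intro conjI subsetI)
    show "x \<in> cspan ((\<lambda>\<alpha>. t (map e \<alpha>)) ` lists J)" if "x \<in> t ` lists (cspan (e ` J))" for x
      using that full_fock_in_span[OF assms, of _ "[]"] by auto
    show "x \<in> cspan (t ` lists (cspan (e ` J)))" if "x \<in> (\<lambda>\<alpha>. t (map e \<alpha>)) ` lists J" for x
      using that by (auto intro!: complex_vector.span_base imageI)
  qed
  then show ?thesis by (simp add: fock_space_def)
qed

lemma full_fock_orthonormal: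
  assumes t: "full_fock (cspan (e ` J)) t" and e: "orthonormal_family J e"
    and "\<alpha> \<in> lists J" "\<beta> \<in> lists J"
  shows "cinner (t (map e \<alpha>)) (t (map e \<beta>)) = (if \<alpha> = \<beta> then 1 else 0)"
proof -
  have "cinner (t (map e \<alpha>)) (t (map e \<beta>)) =
    (if length \<alpha> = length \<beta> then \<Prod>p<length \<alpha>. cinner (map e \<alpha> ! p) (map e \<beta> ! p) else 0)"
  proof -
    have "map e \<alpha> \<in> lists (cspan (e ` J))" "map e \<beta> \<in> lists (cspan (e ` J))"
      using assms by (auto intro!: complex_vector.span_base)
    then show ?thesis using t by (simp add: full_fock_def)
  qed
  also have "\<dots> = (if \<alpha> = \<beta> then 1 else 0)"
  proof (cases "length \<alpha> = length \<beta>")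
    case True
    have "(\<Prod>p<length \<alpha>. cinner (map e \<alpha> ! p) (map e \<beta> ! p)) = (\<Prod>p<length \<alpha>. if \<alpha> ! p = \<beta> ! p then 1 else 0)"
      using assms True by (intro prod.cong refl) (auto simp: orthonormal_family_def in_lists_conv_set)
    also have "\<dots> = (if \<alpha> = \<beta> then 1 else 0)"
      using True by (auto simp: list_eq_iff_nth_eq)
    finally show ?thesis using True by simp
  qed auto
  finally show ?thesis .
qed

section \<open>Multilinearity, continuity and totality of Hilbert tensor families\<close>

lemma hilbert_tensor_family_add:
  assumes \<tau>: "hilbert_tensor_family I F \<tau>" and I: "finite I" "i \<in> I"
    and x: "x \<in> Pi\<^sub>E I F" and uv: "u \<in> F i" "v \<in> F i" "u + v \<in> F i"
  shows "\<tau> (x(i := u + v)) = \<tau> (x(i := u)) + \<tau> (x(i := v))"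
proof (rule cinner_ext_total)
  show "closure (cspan (\<tau> ` Pi\<^sub>E I F)) = UNIV" using \<tau> by (simp add: hilbert_tensor_family_def)
  fix z assume "z \<in> \<tau> ` Pi\<^sub>E I F"
  then obtain y where y: "z = \<tau> y" "y \<in> Pi\<^sub>E I F" by auto
  have "x(i := w) \<in> Pi\<^sub>E I F" if "w \<in> F i" for w
    using x that I by (auto simp: PiE_iff extensional_def)
  moreover have "(\<Prod>j\<in>I. cinner (y j) ((x(i := u + v)) j)) =
    (\<Prod>j\<in>I. cinner (y j) ((x(i := u)) j)) + (\<Prod>j\<in>I. cinner (y j) ((x(i := v)) j))"
    using I by (intro prod_add_one_factor[of _ i]) (auto simp: cinner_add_right)
  ultimately show "cinner z (\<tau> (x(i := u + v))) = cinner z (\<tau> (x(i := u)) + \<tau> (x(i := v)))"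
    using \<tau> y uv by (simp add: hilbert_tensor_family_def cinner_add_right del: fun_upd_apply)
qed

lemma hilbert_tensor_family_scaleC:
  assumes \<tau>: "hilbert_tensor_family I F \<tau>" and I: "finite I" "i \<in> I"
    and x: "x \<in> Pi\<^sub>E I F" and u: "u \<in> F i" "c *\<^sub>C u \<in> F i"
  shows "\<tau> (x(i := c *\<^sub>C u)) = c *\<^sub>C \<tau> (x(i := u))"
proof (rule cinner_ext_total)
  show "closure (cspan (\<tau> ` Pi\<^sub>E I F)) = UNIV" using \<tau> by (simp add: hilbert_tensor_family_def)
  fix z assume "z \<in> \<tau> ` Pi\<^sub>E I F"
  then obtain y where y: "z = \<tau> y" "y \<in> Pi\<^sub>E I F" by auto
  have "x(i := w) \<in> Pi\<^sub>E I F" if "w \<in> F i" for w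
    using x that I by (auto simp: PiE_iff extensional_def)
  moreover have "(\<Prod>j\<in>I. cinner (y j) ((x(i := c *\<^sub>C u)) j)) = c * (\<Prod>j\<in>I. cinner (y j) ((x(i := u)) j))"
    using I by (intro prod_mult_one_factor[of _ i]) (auto simp: cinner_scaleC_right)
  ultimately show "cinner z (\<tau> (x(i := c *\<^sub>C u))) = cinner z (c *\<^sub>C \<tau> (x(i := u)))"
    using \<tau> y u by (simp add: hilbert_tensor_family_def cinner_scaleC_right del: fun_upd_apply)
qed

lemma norm_hilbert_tensor_family:
  assumes \<tau>: "hilbert_tensor_family I F \<tau>" and x: "x \<in> Pi\<^sub>E I F"
  shows "norm (\<tau> x) = (\<Prod>i\<in>I. norm (x i))"
proof -
  have "of_real ((norm (\<tau> x))\<^sup>2) = (\<Prod>i\<in>I. of_real ((norm (x i))\<^sup>2) :: complex)"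
    unfolding cinner_self[symmetric] using \<tau> x unfolding hilbert_tensor_family_def by blast
  also have "\<dots> = of_real ((\<Prod>i\<in>I. norm (x i))\<^sup>2)"
    by (simp add: prod_power_distrib)
  finally have "(norm (\<tau> x))\<^sup>2 = (\<Prod>i\<in>I. norm (x i))\<^sup>2"
    unfolding of_real_eq_iff .
  then show ?thesis by (simp add: prod_nonneg)
qed

text \<open>In one slot the tensor map is additive and scales norms by the fixed product of the
  norms of the other factors.\<close>

lemma hilbert_tensor_family_limit:
  assumes \<tau>: "hilbert_tensor_family I F \<tau>" and I: "finite I" "i \<in> I"
    and x: "x \<in> Pi\<^sub>E I F" and F: "csubspace (F i)" and u: "\<And>n. u n \<in> F i" "v \<in> F i" "u \<longlonglongrightarrow> v"
  shows "(\<lambda>n. \<tau> (x(i := u n))) \<longlonglongrightarrow> \<tau> (x(i := v))"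
proof -
  have upd: "x(i := w) \<in> Pi\<^sub>E I F" if "w \<in> F i" for w
    using x that I by (auto simp: PiE_iff extensional_def)
  have diff: "u n - v \<in> F i" for n
    using F u by (intro complex_vector.subspace_diff)
  have "norm (\<tau> (x(i := u n)) - \<tau> (x(i := v))) = norm (u n - v) * (\<Prod>j\<in>I - {i}. norm (x j))" for n
  proof -
    have "\<tau> (x(i := (u n - v) + v)) = \<tau> (x(i := u n - v)) + \<tau> (x(i := v))"
      using diff u by (intro hilbert_tensor_family_add[OF \<tau> I x]) auto
    then have "norm (\<tau> (x(i := u n)) - \<tau> (x(i := v))) = (\<Prod>j\<in>I. norm ((x(i := u n - v)) j))"
      by (simp add: norm_hilbert_tensor_family[OF \<tau> upd[OF diff]] del: fun_upd_apply)
    also have "\<dots> = norm (u n - v) * (\<Prod>j\<in>I - {i}. norm (x j))"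
      using I by (simp add: prod.remove)
    finally show ?thesis .
  qed
  moreover have "(\<lambda>n. norm (u n - v) * (\<Prod>j\<in>I - {i}. norm (x j))) \<longlonglongrightarrow> 0"
    using u(3) by (intro tendsto_mult_left_zero tendsto_norm_zero LIM_zero)
  ultimately have "(\<lambda>n. norm (\<tau> (x(i := u n)) - \<tau> (x(i := v)))) \<longlonglongrightarrow> 0"
    by presburger
  then show ?thesis
    by (rule LIM_zero_cancel[OF tendsto_norm_zero_cancel])
qed

text \<open>Slots are freed one at a time, \<open>J\<close> being the set of those already free.
  With the other factors fixed, the vectors of slot \<open>i\<close> whose tensor lies in the closed
  span form a closed subspace containing \<open>B i\<close>.\<close>

lemma hilbert_tensor_family_total:
  assumes \<tau>: "hilbert_tensor_family I (\<lambda>i. closure (cspan (B i))) \<tau>" and I: "finite I"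
  shows "closure (cspan (\<tau> ` Pi\<^sub>E I B)) = UNIV"
proof -
  let ?F = "\<lambda>i. closure (cspan (B i))" and ?L = "closure (cspan (\<tau> ` Pi\<^sub>E I B))"
  have L: "csubspace ?L" by (intro csubspace_closure complex_vector.subspace_span)
  have F: "csubspace (?F i)" for i by (intro csubspace_closure complex_vector.subspace_span)
  have BF: "B i \<subseteq> ?F i" for i
    using closure_subset complex_vector.span_superset by blast
  have "\<tau> x \<in> ?L" if "J \<subseteq> I" "\<And>i. i \<in> I \<Longrightarrow> x i \<in> (if i \<in> J then ?F i else B i)" "x \<in> extensional I" for J x
    using finite_subset[OF that(1) I] that
  proof (induction J arbitrary: x rule: finite_induct)
    case empty
    then have "x \<in> Pi\<^sub>E I B" by (auto simp: PiE_iff)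
    then have "\<tau> x \<in> cspan (\<tau> ` Pi\<^sub>E I B)"
      by (intro complex_vector.span_base imageI)
    then show ?case by (rule subsetD[OF closure_subset])
  next
    case (insert i J)
    have i: "i \<in> I" using insert by auto
    have xj: "x j \<in> (if j = i \<or> j \<in> J then ?F j else B j)" if "j \<in> I" for j
      using insert.prems(2)[OF that] by simp
    have "x j \<in> ?F j" if "j \<in> I" for j
      using xj[OF that] BF[of j] by (auto split: if_splits)
    then have x: "x \<in> Pi\<^sub>E I ?F"
      using insert.prems(3) by (auto simp: PiE_iff)
    have upd: "x(i := w) \<in> Pi\<^sub>E I ?F" if "w \<in> ?F i" for w
      using x that i by (auto simp: PiE_iff extensional_def)
    let ?S = "{w \<in> ?F i. \<tau> (x(i := w)) \<in> ?L}"
    have "?F i \<subseteq> ?S"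
    proof (intro closure_minimal complex_vector.span_minimal subsetI)
      fix w assume w: "w \<in> B i"
      have "\<tau> (x(i := w)) \<in> ?L"
      proof (rule insert.IH)
        show "J \<subseteq> I" using insert.prems(1) by simp
        show "(x(i := w)) j \<in> (if j \<in> J then ?F j else B j)" if "j \<in> I" for j
          using xj[OF that] w insert.hyps(2) by (auto split: if_splits)
        show "x(i := w) \<in> extensional I"
          using insert.prems(3) i by (auto simp: extensional_def)
      qed
      then show "w \<in> ?S" using w BF by auto
    next
      have "\<tau> (x(i := 0)) = 0"
        using hilbert_tensor_family_scaleC[OF \<tau> I i x, of 0 0] complex_vector.subspace_0[OF F, of i] by simp
      then show "csubspace ?S"
        using F[of i] L unfolding complex_vector.subspace_def
        by (auto simp: hilbert_tensor_family_add[OF \<tau> I i x] hilbert_tensor_family_scaleC[OF \<tau> I i x]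
          simp del: fun_upd_apply)
      show "closed ?S"
        unfolding closed_sequential_limits
      proof (intro allI impI, elim conjE)
        fix u v assume u: "\<forall>n. u n \<in> ?S" "u \<longlonglongrightarrow> v"
        have v: "v \<in> ?F i"
          using closed_sequentially[of "?F i" u v] u by auto
        have "(\<lambda>n. \<tau> (x(i := u n))) \<longlonglongrightarrow> \<tau> (x(i := v))"
          using u v by (intro hilbert_tensor_family_limit[OF \<tau> I i x F]) auto
        then have "\<tau> (x(i := v)) \<in> ?L"
          using closed_sequentially[of ?L "\<lambda>n. \<tau> (x(i := u n))"] u by auto
        then show "v \<in> ?S" using v by simp
      qed
    qed
    then have "\<tau> (x(i := x i)) \<in> ?L" using x i by (auto simp: PiE_iff)
    then show ?case by simp
  qed
  from this[of I] have "\<tau> ` Pi\<^sub>E I ?F \<subseteq> ?L"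
    by (auto simp: PiE_iff)
  then have "closure (cspan (\<tau> ` Pi\<^sub>E I ?F)) \<subseteq> ?L"
    using L by (intro closure_minimal complex_vector.span_minimal) auto
  then show ?thesis using \<tau> by (auto simp: hilbert_tensor_family_def)
qed

section \<open>Tuples of words and their basis vectors\<close>

lemma words_outside: "\<alpha> \<in> words k n \<Longrightarrow> i \<notin> {1..k} \<Longrightarrow> \<alpha> i = []"
  unfolding words_def by blast

lemma words_inside: "\<alpha> \<in> words k n \<Longrightarrow> i \<in> {1..k} \<Longrightarrow> \<alpha> i \<in> lists {1..n i}"
  unfolding words_def by blast

lemma words_eqI:
  assumes "\<alpha> \<in> words k n" "\<beta> \<in> words k n" "\<And>i. i \<in> {1..k} \<Longrightarrow> \<alpha> i = \<beta> i"
  shows "\<alpha> = \<beta>"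
proof
  show "\<alpha> i = \<beta> i" for i
    using assms(3)[of i] words_outside[OF assms(1), of i] words_outside[OF assms(2), of i]
    by (cases "i \<in> {1..k}") auto
qed

context
  fixes k :: nat and n :: "nat \<Rightarrow> nat"
    and e :: "nat \<Rightarrow> nat \<Rightarrow> 'x::chilbert_space"
    and t :: "nat \<Rightarrow> 'x list \<Rightarrow> 'a::chilbert_space"
    and \<tau> :: "(nat \<Rightarrow> 'a) \<Rightarrow> 'f::chilbert_space"
  assumes e: "\<And>i. i \<in> {1..k} \<Longrightarrow> orthonormal_family {1..n i} (e i)"
    and t: "\<And>i. i \<in> {1..k} \<Longrightarrow> full_fock (cspan (e i ` {1..n i})) (t i)"
    and \<tau>: "hilbert_tensor_family {1..k} (\<lambda>i. fock_space (cspan (e i ` {1..n i})) (t i)) \<tau>"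
begin

lemma fock_basis_orthonormal:
  assumes "\<alpha> \<in> words k n" "\<beta> \<in> words k n"
  shows "cinner (fock_basis k e t \<tau> \<alpha>) (fock_basis k e t \<tau> \<beta>) = (if \<alpha> = \<beta> then 1 else 0)"
proof -
  have "t i (map (e i) (\<alpha> i)) \<in> fock_space (cspan (e i ` {1..n i})) (t i)" if "\<alpha> \<in> words k n" "i \<in> {1..k}" for \<alpha> i
    unfolding fock_space_eq[OF t[OF that(2)]]
    using that by (intro subsetD[OF closure_subset] complex_vector.span_base) (auto simp: words_def)
  then have "cinner (fock_basis k e t \<tau> \<alpha>) (fock_basis k e t \<tau> \<beta>) =
      (\<Prod>i\<in>{1..k}. cinner (t i (map (e i) (\<alpha> i))) (t i (map (e i) (\<beta> i))))"
    using \<tau> assms unfolding fock_basis_def hilbert_tensor_family_def by (subst conjunct1[rule_format]) auto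
  also have "\<dots> = (\<Prod>i\<in>{1..k}. if \<alpha> i = \<beta> i then 1 else 0)"
  proof (intro prod.cong refl)
    fix i assume i: "i \<in> {1..k}"
    then have "\<alpha> i \<in> lists {1..n i}" "\<beta> i \<in> lists {1..n i}"
      using assms unfolding words_def by blast+
    then show "cinner (t i (map (e i) (\<alpha> i))) (t i (map (e i) (\<beta> i))) = (if \<alpha> i = \<beta> i then 1 else 0)"
      by (rule full_fock_orthonormal[OF t[OF i] e[OF i]])
  qed
  also have "\<dots> = (if \<alpha> = \<beta> then 1 else 0)"
  proof (cases "\<alpha> = \<beta>")
    case False
    then obtain i where "i \<in> {1..k}" "\<alpha> i \<noteq> \<beta> i" using words_eqI[OF assms] by blast
    then show ?thesis using False by (auto intro: prod_zero)
  qed simp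
  finally show ?thesis .
qed

lemma fock_basis_total: "closure (cspan (fock_basis k e t \<tau> ` words k n)) = UNIV"
proof -
  let ?B = "\<lambda>i. (\<lambda>\<alpha>. t i (map (e i) \<alpha>)) ` lists {1..n i}"
  have "Pi\<^sub>E {1..k} (\<lambda>i. fock_space (cspan (e i ` {1..n i})) (t i)) = Pi\<^sub>E {1..k} (\<lambda>i. closure (cspan (?B i)))"
    by (intro PiE_cong fock_space_eq t)
  then have "hilbert_tensor_family {1..k} (\<lambda>i. closure (cspan (?B i))) \<tau>"
    using \<tau> by (simp add: hilbert_tensor_family_def)
  then have total: "closure (cspan (\<tau> ` Pi\<^sub>E {1..k} ?B)) = UNIV"
    by (rule hilbert_tensor_family_total) simp
  have sub: "\<tau> ` Pi\<^sub>E {1..k} ?B \<subseteq> fock_basis k e t \<tau> ` words k n"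
  proof clarify
    fix x assume x: "x \<in> Pi\<^sub>E {1..k} ?B"
    then have "\<forall>i\<in>{1..k}. \<exists>\<alpha>. \<alpha> \<in> lists {1..n i} \<and> x i = t i (map (e i) \<alpha>)"
      by (auto simp: PiE_iff image_def)
    then obtain \<alpha> where \<alpha>: "\<And>i. i \<in> {1..k} \<Longrightarrow> \<alpha> i \<in> lists {1..n i} \<and> x i = t i (map (e i) (\<alpha> i))"
      by metis
    \<comment> \<open>\<open>\<alpha>\<close> is arbitrary outside \<open>{1..k}\<close>, whereas
      \<open>words\<close> demands the empty word there.\<close>
    define \<beta> where "\<beta> = (\<lambda>i. if i \<in> {1..k} then \<alpha> i else [])"
    have "x = (\<lambda>i\<in>{1..k}. t i (map (e i) (\<beta> i)))"
      using x \<alpha> by (auto simp: \<beta>_def PiE_iff extensional_def restrict_def)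
    moreover have "\<beta> \<in> words k n" using \<alpha> by (auto simp: \<beta>_def words_def)
    ultimately show "\<tau> x \<in> fock_basis k e t \<tau> ` words k n"
      unfolding fock_basis_def by blast
  qed
  show ?thesis
    using closure_mono[OF complex_vector.span_mono[OF sub]] total by auto
qed

end

section \<open>Tensor products of operators\<close>

locale tensor_product =
  fixes tens :: "'e::chilbert_space \<Rightarrow> 'f::chilbert_space \<Rightarrow> 'h::chilbert_space"
  assumes tens: "hilbert_tensor tens"
begin

lemma cinner_tens: "cinner (tens x \<xi>) (tens y \<eta>) = cinner x y * cinner \<xi> \<eta>"
  using tens unfolding hilbert_tensor_def by blast

lemma tens_total: "closure (cspan (range (\<lambda>(x, \<xi>). tens x \<xi>))) = UNIV"
  using tens unfolding hilbert_tensor_def by blast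

lemma tens_ext: "p = q" if "\<And>x \<xi>. cinner (tens x \<xi>) p = cinner (tens x \<xi>) q"
  using tens_total by (rule cinner_ext_total) (use that in auto)

lemma tens_add_right: "tens x (\<xi> + \<eta>) = tens x \<xi> + tens x \<eta>"
  by (rule tens_ext) (simp add: cinner_tens cinner_add_right distrib_left)

lemma tens_scaleC_left: "tens (c *\<^sub>C x) \<xi> = c *\<^sub>C tens x \<xi>"
  by (rule tens_ext) (simp add: cinner_tens cinner_scaleC_right)

lemma tens_scaleC_right: "tens x (c *\<^sub>C \<xi>) = c *\<^sub>C tens x \<xi>"
  by (rule tens_ext) (simp add: cinner_tens cinner_scaleC_right)

lemma norm_tens: "norm (tens x \<xi>) = norm x * norm \<xi>"
proof -
  have "(of_real ((norm (tens x \<xi>))\<^sup>2) :: complex) = of_real ((norm x * norm \<xi>)\<^sup>2)"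
    by (simp only: cinner_self[symmetric] cinner_tens power_mult_distrib of_real_mult)
  then have "(norm (tens x \<xi>))\<^sup>2 = (norm x * norm \<xi>)\<^sup>2"
    unfolding of_real_eq_iff .
  then show ?thesis by simp
qed

lemma bounded_linear_tens_right: "bounded_linear (tens x)"
  by (rule bounded_linear_intro[where K="norm x"])
    (auto simp: tens_add_right scaleR_scaleC tens_scaleC_right norm_tens)

lemma is_tensor_op_unique: "is_tensor_op tens T a G \<Longrightarrow> is_tensor_op tens T a G' \<Longrightarrow> G = G'"
  using tens_total unfolding is_tensor_op_def by (elim conjE cblinops_eq_total) auto

lemma tensor_op_eq: "is_tensor_op tens T a G \<Longrightarrow> tensor_op tens T a = G"
  unfolding tensor_op_def using is_tensor_op_unique by blast

text \<open>The definition of \<open>multi_toeplitz\<close> tensors the identity with an adjoint;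
  knowing this to be the adjoint of the tensor product, one can move it across inner
  products.\<close>

lemma is_tensor_op_cadj:
  assumes G: "is_tensor_op tens id_blinfun a G" and a: "a \<in> cblinops"
  shows "is_tensor_op tens id_blinfun (cadj a) (cadj G)"
  unfolding is_tensor_op_def
proof (intro conjI allI)
  have Gc: "G \<in> cblinops" using G by (simp add: is_tensor_op_def)
  then show "cadj G \<in> cblinops" by (rule cadj_in_cblinops)
  show "cadj G (tens x \<xi>) = tens (id_blinfun x) (cadj a \<xi>)" for x \<xi>
    using G by (intro tens_ext) (simp add: cinner_cadj_right[OF Gc] cinner_cadj_right[OF a] cinner_tens is_tensor_op_def)
qed

end

section \<open>Creation operators\<close>

lemma upd_in_words: "\<alpha> \<in> words k n \<Longrightarrow> i \<in> {1..k} \<Longrightarrow> w \<in> lists {1..n i} \<Longrightarrow> \<alpha>(i := w) \<in> words k n"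
  unfolding words_def by simp

text \<open>From here on the Fock spaces are present only through the orthonormal total family
  \<open>b\<close> indexed by tuples of words.\<close>

locale polyball = tensor_product tens
  for tens :: "'e::chilbert_space \<Rightarrow> 'f::chilbert_space \<Rightarrow> 'h::chilbert_space" +
  fixes k :: nat and n :: "nat \<Rightarrow> nat" and b :: "(nat \<Rightarrow> nat list) \<Rightarrow> 'f"
  assumes cinner_b: "\<And>\<alpha> \<beta>. \<alpha> \<in> words k n \<Longrightarrow> \<beta> \<in> words k n \<Longrightarrow> cinner (b \<alpha>) (b \<beta>) = (if \<alpha> = \<beta> then 1 else 0)"
    and b_total: "closure (cspan (b ` words k n)) = UNIV"
begin

abbreviation "W \<equiv> words k n"
abbreviation "V \<alpha> u \<equiv> tens u (b \<alpha>)"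
abbreviation "lcr \<equiv> left_creation k n b"
abbreviation "rcr \<equiv> right_creation k n b"
abbreviation "Rcr i s \<equiv> tensor_op tens id_blinfun (rcr i s)"

sublocale fock: hilbert_sum W "\<lambda>\<alpha> c. c *\<^sub>C b \<alpha>"
proof
  show "cinner (c *\<^sub>C b \<alpha>) (d *\<^sub>C b \<beta>) = (if \<alpha> = \<beta> then cinner c d else 0)" if "\<alpha> \<in> W" "\<beta> \<in> W" for \<alpha> \<beta> c d
    using that by (simp add: cinner_scaleC_left cinner_scaleC_right cinner_b cinner_complex_def)
  have "b \<alpha> = 1 *\<^sub>C b \<alpha>" for \<alpha> by (simp add: scaleC_one)
  then have "b ` W \<subseteq> {c *\<^sub>C b \<alpha> | \<alpha> c. \<alpha> \<in> W}" by blast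
  from closure_mono[OF complex_vector.span_mono[OF this]]
  show "closure (cspan {c *\<^sub>C b \<alpha> | \<alpha> c. \<alpha> \<in> W}) = UNIV" using b_total by auto
qed

sublocale full: hilbert_sum W V
proof
  show "cinner (V \<alpha> u) (V \<beta> v) = (if \<alpha> = \<beta> then cinner u v else 0)" if "\<alpha> \<in> W" "\<beta> \<in> W" for \<alpha> \<beta> u v
    using that by (simp add: cinner_tens cinner_b)
  let ?L = "closure (cspan {V \<alpha> u | \<alpha> u. \<alpha> \<in> W})"
  have L: "csubspace ?L" by (intro csubspace_closure complex_vector.subspace_span)
  \<comment> \<open>With \<open>u\<close> fixed, \<open>tens u\<close> is bounded and complex
    linear, so it is enough to treat word vectors \<open>\<xi>\<close>.\<close>
  have "tens u \<xi> \<in> ?L" for u \<xi>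
    using b_total
  proof (induction \<xi> rule: total_induct)
    case (base \<xi>)
    then show ?case by (intro subsetD[OF closure_subset] complex_vector.span_base) auto
  next
    case closed
    have "closed (tens u -` ?L)"
      by (intro closed_vimage linear_continuous_on bounded_linear_tens_right closed_closure)
    then show ?case by (simp add: vimage_def)
  next
    case subspace
    have "tens u 0 = 0" by (rule tens_ext) (simp add: cinner_tens)
    then show ?case
      using L by (auto simp: complex_vector.subspace_def tens_add_right tens_scaleC_right)
  qed
  then have "range (\<lambda>(x, \<xi>). tens x \<xi>) \<subseteq> ?L" by auto
  then have "closure (cspan (range (\<lambda>(x, \<xi>). tens x \<xi>))) \<subseteq> ?L"
    using L by (intro closure_minimal complex_vector.span_minimal) auto
  then show "?L = UNIV" using tens_total by auto
qed

lemma fock_operator_exists: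
  assumes "inj_on \<sigma> W" "\<sigma> ` W \<subseteq> W"
  obtains A where "A \<in> cblinops" "\<And>\<alpha>. \<alpha> \<in> W \<Longrightarrow> blinfun_apply A (b \<alpha>) = b (\<sigma> \<alpha>)"
proof -
  obtain G where G: "G \<in> cblinops" "\<And>\<alpha> c. \<alpha> \<in> W \<Longrightarrow> blinfun_apply G (c *\<^sub>C b \<alpha>) = id_blinfun c *\<^sub>C b (\<sigma> \<alpha>)" "norm G \<le> 1"
    by (rule fock.operator_exists[where T="\<lambda>_. id_blinfun" and K=1, OF assms id_in_cblinops norm_blinfun_id_le zero_le_one], rule that)
  show thesis
    using G(1) G(2)[of _ 1] by (intro that) (simp_all add: scaleC_one)
qed

lemma fock_operator_eqI:
  assumes "A \<in> cblinops" "B \<in> cblinops" "\<And>\<alpha>. \<alpha> \<in> W \<Longrightarrow> blinfun_apply A (b \<alpha>) = blinfun_apply B (b \<alpha>)"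
  shows "A = B"
  using b_total assms(1,2) by (rule cblinops_eq_total) (use assms(3) in blast)

lemma append_in_words: "\<alpha> \<in> W \<Longrightarrow> i \<in> {1..k} \<Longrightarrow> s \<in> {1..n i} \<Longrightarrow> \<alpha>(i := \<alpha> i @ [s]) \<in> W"
  by (rule upd_in_words) (use words_inside in auto)

lemma Cons_in_words: "\<alpha> \<in> W \<Longrightarrow> i \<in> {1..k} \<Longrightarrow> s \<in> {1..n i} \<Longrightarrow> \<alpha>(i := s # \<alpha> i) \<in> W"
  by (rule upd_in_words) (use words_inside in auto)

text \<open>Appending a letter is injective on tuples of words, which gives existence; totality of
  \<open>b\<close> gives uniqueness. Hence the definite description denotes an operator.\<close>

lemma right_creation:
  assumes "i \<in> {1..k}" "s \<in> {1..n i}"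
  shows rcr_cblinops: "rcr i s \<in> cblinops"
    and rcr_b: "\<alpha> \<in> W \<Longrightarrow> rcr i s (b \<alpha>) = b (\<alpha>(i := \<alpha> i @ [s]))"
proof -
  have inj: "inj_on (\<lambda>\<alpha>. \<alpha>(i := \<alpha> i @ [s])) W"
    by (rule inj_onI) (metis append_same_eq ext fun_upd_apply)
  have im: "(\<lambda>\<alpha>. \<alpha>(i := \<alpha> i @ [s])) ` W \<subseteq> W"
    using append_in_words[OF _ assms] by blast
  obtain A where A: "A \<in> cblinops" "\<And>\<alpha>. \<alpha> \<in> W \<Longrightarrow> blinfun_apply A (b \<alpha>) = b (\<alpha>(i := \<alpha> i @ [s]))"
    by (rule fock_operator_exists[OF inj im], rule that)
  then have "rcr i s = A"
    unfolding right_creation_def by (intro the_equality) (auto intro: fock_operator_eqI)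
  with A show "rcr i s \<in> cblinops" "\<alpha> \<in> W \<Longrightarrow> rcr i s (b \<alpha>) = b (\<alpha>(i := \<alpha> i @ [s]))" by auto
qed

lemma left_creation:
  assumes "i \<in> {1..k}" "s \<in> {1..n i}"
  shows lcr_cblinops: "lcr i s \<in> cblinops"
    and lcr_b: "\<alpha> \<in> W \<Longrightarrow> lcr i s (b \<alpha>) = b (\<alpha>(i := s # \<alpha> i))"
proof -
  have inj: "inj_on (\<lambda>\<alpha>. \<alpha>(i := s # \<alpha> i)) W"
    by (rule inj_onI) (metis list.inject ext fun_upd_apply)
  have im: "(\<lambda>\<alpha>. \<alpha>(i := s # \<alpha> i)) ` W \<subseteq> W"
    using Cons_in_words[OF _ assms] by blast
  obtain A where A: "A \<in> cblinops" "\<And>\<alpha>. \<alpha> \<in> W \<Longrightarrow> blinfun_apply A (b \<alpha>) = b (\<alpha>(i := s # \<alpha> i))"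
    by (rule fock_operator_exists[OF inj im], rule that)
  then have "lcr i s = A"
    unfolding left_creation_def by (intro the_equality) (auto intro: fock_operator_eqI)
  with A show "lcr i s \<in> cblinops" "\<alpha> \<in> W \<Longrightarrow> lcr i s (b \<alpha>) = b (\<alpha>(i := s # \<alpha> i))" by auto
qed

text \<open>Boundedness is immediate when \<open>a\<close> maps word vectors injectively to word
  vectors. This covers the right creation operators and the monomials in the left ones.\<close>

lemma is_tensor_op_exists:
  assumes T: "T \<in> cblinops" and a: "a \<in> cblinops" "\<And>\<alpha>. \<alpha> \<in> W \<Longrightarrow> blinfun_apply a (b \<alpha>) = b (\<sigma> \<alpha>)"
    and \<sigma>: "inj_on \<sigma> W" "\<sigma> ` W \<subseteq> W"
  obtains G where "is_tensor_op tens T a G"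
proof -
  obtain G where G: "G \<in> cblinops" "\<And>\<alpha> u. \<alpha> \<in> W \<Longrightarrow> blinfun_apply G (V \<alpha> u) = V (\<sigma> \<alpha>) (T u)" "norm G \<le> norm T"
    by (rule full.operator_exists[where T="\<lambda>_. T" and K="norm T", OF \<sigma> T order_refl norm_ge_zero], rule that)
  have "G (tens u \<xi>) = tens (T u) (a \<xi>)" for u \<xi>
    using b_total
  proof (induction \<xi> rule: total_induct)
    case (base \<xi>)
    then show ?case using G a by auto
  next
    case closed
    show ?case
      by (intro closed_Collect_eq continuous_intros bounded_linear.continuous_on[OF bounded_linear_tens_right])
  next
    case subspace
    have "tens v 0 = 0" for v by (rule tens_ext) (simp add: cinner_tens)
    then show ?case
      by (auto simp: complex_vector.subspace_def tens_add_right tens_scaleC_right blinfun.add_right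
          cblinopsD[OF G(1)] cblinopsD[OF a(1)])
  qed
  with G(1) show thesis by (intro that) (auto simp: is_tensor_op_def)
qed

lemma is_tensor_op_Rcr:
  assumes "i \<in> {1..k}" "s \<in> {1..n i}"
  shows "is_tensor_op tens id_blinfun (rcr i s) (Rcr i s)"
proof -
  have inj: "inj_on (\<lambda>\<alpha>. \<alpha>(i := \<alpha> i @ [s])) W"
    by (rule inj_onI) (metis append_same_eq ext fun_upd_apply)
  have im: "(\<lambda>\<alpha>. \<alpha>(i := \<alpha> i @ [s])) ` W \<subseteq> W"
    using append_in_words[OF _ assms] by blast
  obtain G where "is_tensor_op tens id_blinfun (rcr i s) G"
    using is_tensor_op_exists[where \<sigma>="\<lambda>\<alpha>. \<alpha>(i := \<alpha> i @ [s])", OF id_in_cblinops right_creation[OF assms] inj im] .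
  then show ?thesis using tensor_op_eq by blast
qed

lemma Rcr:
  assumes "i \<in> {1..k}" "s \<in> {1..n i}"
  shows Rcr_cblinops: "Rcr i s \<in> cblinops"
    and Rcr_tens: "Rcr i s (tens x \<xi>) = tens x (rcr i s \<xi>)"
    and Rcr_V: "\<alpha> \<in> W \<Longrightarrow> Rcr i s (V \<alpha> u) = V (\<alpha>(i := \<alpha> i @ [s])) u"
    and cadj_Rcr: "tensor_op tens id_blinfun (cadj (rcr i s)) = cadj (Rcr i s)"
  using is_tensor_op_Rcr[OF assms] is_tensor_op_cadj[OF is_tensor_op_Rcr[OF assms] right_creation(1)[OF assms]]
    right_creation(2)[OF assms]
  by (auto simp: is_tensor_op_def intro!: tensor_op_eq)

section \<open>Multi-Toeplitz operators\<close>

text \<open>Written with matrix elements, the Toeplitz conditions become equations between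
  functionals \<open>A \<mapsto> \<langle>y, A x\<rangle>\<close>, which are continuous in both
  operator topologies.\<close>

lemma multi_toeplitz_iff:
  "A \<in> multi_toeplitz k n b tens \<longleftrightarrow> A \<in> cblinops \<and>
    (\<forall>i\<in>{1..k}. \<forall>s\<in>{1..n i}. \<forall>t\<in>{1..n i}. \<forall>x y.
       cinner (Rcr i s x) (A (Rcr i t y)) = (if s = t then cinner x (A y) else 0))"
proof -
  have "cadj (Rcr i s) o\<^sub>L A o\<^sub>L Rcr i t = (if s = t then A else 0) \<longleftrightarrow>
    (\<forall>x y. cinner (Rcr i s x) (A (Rcr i t y)) = (if s = t then cinner x (A y) else 0))"
    if "i \<in> {1..k}" "s \<in> {1..n i}" for i s t
  proof
    assume "cadj (Rcr i s) o\<^sub>L A o\<^sub>L Rcr i t = (if s = t then A else 0)"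
    then have "cadj (Rcr i s) (A (Rcr i t y)) = (if s = t then A y else 0)" for y
      by (metis blinfun_apply_blinfun_compose zero_blinfun.rep_eq)
    then show "\<forall>x y. cinner (Rcr i s x) (A (Rcr i t y)) = (if s = t then cinner x (A y) else 0)"
      by (auto simp flip: cinner_cadj_right[OF Rcr_cblinops[OF that]])
  next
    assume *: "\<forall>x y. cinner (Rcr i s x) (A (Rcr i t y)) = (if s = t then cinner x (A y) else 0)"
    show "cadj (Rcr i s) o\<^sub>L A o\<^sub>L Rcr i t = (if s = t then A else 0)"
      by (intro blinfun_eqI, rule cinner_ext) (simp add: cinner_cadj_right[OF Rcr_cblinops[OF that]] *)
  qed
  then show ?thesis
    unfolding multi_toeplitz_def by (simp add: cadj_Rcr)
qed

lemma multi_toeplitzD: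
  assumes "A \<in> multi_toeplitz k n b tens" "i \<in> {1..k}" "s \<in> {1..n i}" "t \<in> {1..n i}"
  shows "cinner (Rcr i s x) (A (Rcr i t y)) = (if s = t then cinner x (A y) else 0)"
  using assms unfolding multi_toeplitz_iff by blast

text \<open>Only continuity of the matrix elements enters, so one proof serves the strong and the
  weak topology.\<close>

lemma closedin_multi_toeplitz:
  assumes X: "topspace X = UNIV"
    and cont: "\<And>x y. continuous_map X euclidean (\<lambda>A. cinner y (blinfun_apply A x))"
  shows "closedin X (multi_toeplitz k n b tens)"
proof -
  have eq: "closedin X {A. f A = g A}"
    if "continuous_map X euclidean f" "continuous_map X euclidean g" for f g :: "_ \<Rightarrow> complex"
    using closedin_continuous_maps_eq[OF _ that] X by simp
  have all: "closedin X {A. \<forall>p. P p A}" if "\<And>p. closedin X {A. P p A}" for P :: "'p \<Rightarrow> _ \<Rightarrow> bool"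
  proof -
    have "{A. \<forall>p. P p A} = (\<Inter>p. {A. P p A})" by auto
    then show ?thesis using that by auto
  qed
  have imp: "closedin X {A. Q \<longrightarrow> P A}" if "Q \<Longrightarrow> closedin X {A. P A}" for P Q
    using that X closedin_topspace[of X] by (cases Q) auto
  have "multi_toeplitz k n b tens =
    {A. \<forall>c x z. cinner z (blinfun_apply A (c *\<^sub>C x)) = cinner (cnj c *\<^sub>C z) (blinfun_apply A x)} \<inter>
    {A. \<forall>i. i \<in> {1..k} \<longrightarrow> (\<forall>s. s \<in> {1..n i} \<longrightarrow> (\<forall>t. t \<in> {1..n i} \<longrightarrow> (\<forall>x y.
       cinner (Rcr i s x) (blinfun_apply A (Rcr i t y)) = (if s = t then cinner x (blinfun_apply A y) else 0))))}"
  proof -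
    \<comment> \<open>Complex homogeneity has to survive limits as well, since the operator type
      contains all real-linear maps; it too is a family of equations between matrix
      elements.\<close>
    have "A \<in> cblinops \<longleftrightarrow> (\<forall>c x z. cinner z (A (c *\<^sub>C x)) = cinner (cnj c *\<^sub>C z) (A x))" for A :: "'h \<Rightarrow>\<^sub>L 'h"
    proof
      assume *: "\<forall>c x z. cinner z (A (c *\<^sub>C x)) = cinner (cnj c *\<^sub>C z) (A x)"
      show "A \<in> cblinops"
        unfolding cblinops_iff
        by (intro allI, rule cinner_ext) (simp add: * cinner_scaleC_left cinner_scaleC_right)
    qed (simp add: cblinopsD cinner_scaleC_left cinner_scaleC_right)
    then show ?thesis
      unfolding set_eq_iff multi_toeplitz_iff Ball_def by simp
  qed
  moreover have "closedin X {A. \<forall>c x z. cinner z (blinfun_apply A (c *\<^sub>C x)) = cinner (cnj c *\<^sub>C z) (blinfun_apply A x)}"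
    by (intro all eq cont)
  moreover have "closedin X {A. \<forall>i. i \<in> {1..k} \<longrightarrow> (\<forall>s. s \<in> {1..n i} \<longrightarrow> (\<forall>t. t \<in> {1..n i} \<longrightarrow> (\<forall>x y.
       cinner (Rcr i s x) (blinfun_apply A (Rcr i t y)) = (if s = t then cinner x (blinfun_apply A y) else 0))))}"
  proof (intro all imp)
    show "closedin X {A. cinner (Rcr i s x) (blinfun_apply A (Rcr i t y)) = (if s = t then cinner x (blinfun_apply A y) else 0)}"
      for i s t x y
      by (cases "s = t") (auto intro!: eq cont)
  qed
  ultimately show ?thesis by (simp add: closedin_Int)
qed

text \<open>The operators commuting with all right creation operators form a norm closed algebra. It
  contains the generators because prepending and appending letters commute, even in the same
  coordinate and at the empty word.\<close>

lemma polyball_algebra_commutes: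
  assumes a: "a \<in> polyball_algebra k n b"
  shows "a \<in> cblinops" "i \<in> {1..k} \<Longrightarrow> t \<in> {1..n i} \<Longrightarrow> a (rcr i t \<xi>) = rcr i t (a \<xi>)"
proof -
  let ?C = "cblinops \<inter> {a. \<forall>i\<in>{1..k}. \<forall>t\<in>{1..n i}. \<forall>\<xi>. blinfun_apply a (rcr i t \<xi>) = rcr i t (blinfun_apply a \<xi>)}"
  have "polyball_algebra k n b \<subseteq> ?C"
    unfolding polyball_algebra_def normclosed_algebra_generated_def
  proof (intro Inter_lower CollectI conjI)
    have "blinfun_apply (lcr i j) (rcr i' t \<xi>) = rcr i' t (lcr i j \<xi>)"
      if "i \<in> {1..k}" "j \<in> {1..n i}" "i' \<in> {1..k}" "t \<in> {1..n i'}" for i j i' t \<xi>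
    proof -
      have "lcr i j o\<^sub>L rcr i' t = rcr i' t o\<^sub>L lcr i j"
      proof (rule fock_operator_eqI)
        fix \<alpha> assume \<alpha>: "\<alpha> \<in> W"
        have "(\<alpha>(i' := \<alpha> i' @ [t]))(i := j # (\<alpha>(i' := \<alpha> i' @ [t])) i) =
          (\<alpha>(i := j # \<alpha> i))(i' := (\<alpha>(i := j # \<alpha> i)) i' @ [t])"
          by auto
        then show "(lcr i j o\<^sub>L rcr i' t) (b \<alpha>) = (rcr i' t o\<^sub>L lcr i j) (b \<alpha>)"
          using that \<alpha> by (simp add: left_creation right_creation Cons_in_words append_in_words del: fun_upd_apply)
      qed (use that in \<open>auto intro!: cblinops_compose left_creation right_creation\<close>)
      then show ?thesis by (metis blinfun_apply_blinfun_compose)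
    qed
    then show "insert id_blinfun {lcr i j |i j. i \<in> {1..k} \<and> j \<in> {1..n i}} \<subseteq> ?C"
      by (auto simp: id_in_cblinops left_creation)
    show "closed ?C"
    proof (intro closed_Int closed_cblinops)
      have "{a. \<forall>i\<in>{1..k}. \<forall>t\<in>{1..n i}. \<forall>\<xi>. blinfun_apply a (rcr i t \<xi>) = rcr i t (blinfun_apply a \<xi>)} =
        (\<Inter>i\<in>{1..k}. \<Inter>t\<in>{1..n i}. \<Inter>\<xi>. {a. blinfun_apply a (rcr i t \<xi>) = rcr i t (blinfun_apply a \<xi>)})"
        by auto
      moreover have "closed {a. blinfun_apply a (rcr i t \<xi>) = rcr i t (blinfun_apply a \<xi>)}" for i t \<xi>
        by (intro closed_Collect_eq continuous_intros)
      ultimately show "closed {a. \<forall>i\<in>{1..k}. \<forall>t\<in>{1..n i}. \<forall>\<xi>. blinfun_apply a (rcr i t \<xi>) = rcr i t (blinfun_apply a \<xi>)}"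
        by (auto intro!: closed_INT)
    qed
    show "csubspace ?C"
      using csubspace_cblinops
      by (auto simp: complex_vector.subspace_def blinfun.add_left blinfun.add_right scaleC_blinfun.rep_eq
          cblinopsD[OF right_creation(1)])
    show "\<forall>A\<in>?C. \<forall>B\<in>?C. A o\<^sub>L B \<in> ?C"
      by (auto simp: cblinops_compose)
  qed
  then show "a \<in> cblinops" "i \<in> {1..k} \<Longrightarrow> t \<in> {1..n i} \<Longrightarrow> a (rcr i t \<xi>) = rcr i t (a \<xi>)"
    using a by auto
qed

abbreviation "M \<equiv> spatial_tensor tens cblinops (polyball_algebra k n b)"

text \<open>\<open>Rcr i t\<close> acts on the second tensor factor alone, so \<open>T\<close> does
  not interfere and commutation is inherited from \<open>a\<close>; it then passes to the closed
  span.\<close>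

lemma spatial_tensor_commutes:
  assumes f: "f \<in> M"
  shows "f \<in> cblinops" "i \<in> {1..k} \<Longrightarrow> t \<in> {1..n i} \<Longrightarrow> f (Rcr i t x) = Rcr i t (f x)"
proof -
  let ?C = "cblinops \<inter> {a. \<forall>i\<in>{1..k}. \<forall>t\<in>{1..n i}. \<forall>\<xi>. blinfun_apply a (Rcr i t \<xi>) = Rcr i t (blinfun_apply a \<xi>)}"
  have "M \<subseteq> ?C"
    unfolding spatial_tensor_def
  proof (intro closure_minimal complex_vector.span_minimal)
    show "{G. \<exists>T\<in>cblinops. \<exists>a\<in>polyball_algebra k n b. is_tensor_op tens T a G} \<subseteq> ?C"
    proof (clarify, intro IntI CollectI ballI allI)
      fix G T a i t x
      assume T: "T \<in> cblinops" and a: "a \<in> polyball_algebra k n b" and G: "is_tensor_op tens T a G"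
      show Gc: "G \<in> cblinops" using G by (simp add: is_tensor_op_def)
      assume it: "i \<in> {1..k}" "t \<in> {1..n i}"
      have "G o\<^sub>L Rcr i t = Rcr i t o\<^sub>L G"
        using tens_total
      proof (rule cblinops_eq_total)
        show "blinfun_apply (G o\<^sub>L Rcr i t) x = blinfun_apply (Rcr i t o\<^sub>L G) x" if "x \<in> range (\<lambda>(x, \<xi>). tens x \<xi>)" for x
          using that G polyball_algebra_commutes(2)[OF a it] by (auto simp: Rcr_tens[OF it] is_tensor_op_def)
      qed (intro cblinops_compose Gc Rcr_cblinops[OF it])+
      then show "G (Rcr i t x) = Rcr i t (G x)" by (metis blinfun_apply_blinfun_compose)
    qed
    show "closed ?C"
    proof (intro closed_Int closed_cblinops)
      have "{a. \<forall>i\<in>{1..k}. \<forall>t\<in>{1..n i}. \<forall>\<xi>. blinfun_apply a (Rcr i t \<xi>) = Rcr i t (blinfun_apply a \<xi>)} =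
        (\<Inter>i\<in>{1..k}. \<Inter>t\<in>{1..n i}. \<Inter>\<xi>. {a. blinfun_apply a (Rcr i t \<xi>) = Rcr i t (blinfun_apply a \<xi>)})"
        by auto
      moreover have "closed {a. blinfun_apply a (Rcr i t \<xi>) = Rcr i t (blinfun_apply a \<xi>)}" for i t \<xi>
        by (intro closed_Collect_eq continuous_intros)
      ultimately show "closed {a. \<forall>i\<in>{1..k}. \<forall>t\<in>{1..n i}. \<forall>\<xi>. blinfun_apply a (Rcr i t \<xi>) = Rcr i t (blinfun_apply a \<xi>)}"
        by (auto intro!: closed_INT)
    qed
    show "csubspace ?C"
      using csubspace_cblinops
      by (auto simp: complex_vector.subspace_def blinfun.add_left blinfun.add_right scaleC_blinfun.rep_eq
          cblinopsD[OF Rcr_cblinops])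
  qed
  then show "f \<in> cblinops" "i \<in> {1..k} \<Longrightarrow> t \<in> {1..n i} \<Longrightarrow> f (Rcr i t x) = Rcr i t (f x)"
    using f by auto
qed

text \<open>After appending \<open>s\<close> and \<open>t\<close>, two words agree only if
  \<open>s = t\<close> and they agreed before. This decides the product of adjoint and operator on
  word vectors, hence everywhere.\<close>

lemma cinner_Rcr:
  assumes "i \<in> {1..k}" "s \<in> {1..n i}" "t \<in> {1..n i}"
  shows "cinner (Rcr i s x) (Rcr i t y) = (if s = t then cinner x y else 0)"
proof -
  have "cadj (Rcr i s) o\<^sub>L Rcr i t = (if s = t then id_blinfun else 0)"
  proof (rule full.operator_eqI)
    show "cadj (Rcr i s) o\<^sub>L Rcr i t \<in> cblinops"
      using assms by (intro cblinops_compose cadj_in_cblinops Rcr_cblinops)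
    show "(if s = t then id_blinfun else 0) \<in> cblinops"
      by (simp add: id_in_cblinops complex_vector.subspace_0[OF csubspace_cblinops])
    fix \<alpha> u assume \<alpha>: "\<alpha> \<in> W"
    have "\<beta>(i := \<beta> i @ [s]) = \<alpha>(i := \<alpha> i @ [t]) \<longleftrightarrow> s = t \<and> \<beta> = \<alpha>" for \<beta>
    proof
      assume *: "\<beta>(i := \<beta> i @ [s]) = \<alpha>(i := \<alpha> i @ [t])"
      have "\<beta> j = \<alpha> j" for j
        using fun_cong[OF *, of j] by (cases "j = i") auto
      moreover have "s = t" using fun_cong[OF *, of i] by simp
      ultimately show "s = t \<and> \<beta> = \<alpha>" by auto
    qed auto
    then have "cinner (V \<beta> v) (cadj (Rcr i s) (Rcr i t (V \<alpha> u))) = cinner (V \<beta> v) (if s = t then V \<alpha> u else 0)"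
      if "\<beta> \<in> W" for \<beta> v
      using that \<alpha> assms
      by (simp add: cinner_cadj_right Rcr_cblinops Rcr_V full.cinner_V append_in_words del: fun_upd_apply)
    then have "cadj (Rcr i s) (Rcr i t (V \<alpha> u)) = (if s = t then V \<alpha> u else 0)"
      by (rule full.V_ext)
    then show "(cadj (Rcr i s) o\<^sub>L Rcr i t) (V \<alpha> u) = (if s = t then id_blinfun else 0) (V \<alpha> u)"
      by simp
  qed
  then have "cadj (Rcr i s) (Rcr i t y) = (if s = t then y else 0)"
    by (metis blinfun_apply_blinfun_compose blinfun_apply_id_blinfun id_apply zero_blinfun.rep_eq)
  then show ?thesis
    using cinner_cadj_right[OF Rcr_cblinops[OF assms(1,2)], of x "Rcr i t y"] by auto
qed

text \<open>Moving \<open>f\<close> across the inner product, and \<open>f\<close> and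
  \<open>g\<close> past the right creation operators, gives the inner product of
  \<open>Rcr i s (f x)\<close> and \<open>Rcr i t (g y)\<close>, to which \<open>cinner_Rcr\<close>
  applies.\<close>

lemma span_subset_multi_toeplitz:
  "cspan {cadj f o\<^sub>L g | f g. f \<in> M \<and> g \<in> M} \<subseteq> multi_toeplitz k n b tens"
proof (rule complex_vector.span_minimal)
  show "{cadj f o\<^sub>L g | f g. f \<in> M \<and> g \<in> M} \<subseteq> multi_toeplitz k n b tens"
  proof clarify
    fix f g assume f: "f \<in> M" and g: "g \<in> M"
    note fc = spatial_tensor_commutes(1)[OF f] and gc = spatial_tensor_commutes(1)[OF g]
    show "cadj f o\<^sub>L g \<in> multi_toeplitz k n b tens"
      unfolding multi_toeplitz_iff
    proof (intro conjI ballI allI)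
      show "cadj f o\<^sub>L g \<in> cblinops" using fc gc by (intro cblinops_compose cadj_in_cblinops)
      fix i s t x y assume "i \<in> {1..k}" "s \<in> {1..n i}" "t \<in> {1..n i}"
      then show "cinner (Rcr i s x) ((cadj f o\<^sub>L g) (Rcr i t y)) = (if s = t then cinner x ((cadj f o\<^sub>L g) y) else 0)"
        by (simp add: cinner_cadj_right[OF fc] spatial_tensor_commutes(2)[OF f]
            spatial_tensor_commutes(2)[OF g] cinner_Rcr)
    qed
  qed
  show "csubspace (multi_toeplitz k n b tens)"
    using csubspace_cblinops
    by (auto simp: complex_vector.subspace_def multi_toeplitz_iff blinfun.add_left cinner_add_right
        scaleC_blinfun.rep_eq cinner_scaleC_right)
qed

end

section \<open>Fejer weights on pairs of words\<close>

definition word_mult :: "(nat \<Rightarrow> nat list) \<Rightarrow> (nat \<Rightarrow> nat list) \<Rightarrow> nat \<Rightarrow> nat list"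
  where "word_mult \<alpha> \<gamma> = (\<lambda>i. \<alpha> i @ \<gamma> i)"

lemma word_mult_in_words: "\<alpha> \<in> words k n \<Longrightarrow> \<gamma> \<in> words k n \<Longrightarrow> word_mult \<alpha> \<gamma> \<in> words k n"
  unfolding words_def word_mult_def by auto

lemma inj_word_mult: "inj (word_mult \<alpha>)"
  by (rule injI) (auto simp: word_mult_def fun_eq_iff)

text \<open>A cube of side \<open>N\<close> with lowest corner at the multi-length of
  \<open>\<delta>\<close>. Overlap counts are inner products of indicator functions; divided by
  \<open>N ^ k\<close> they are the coefficients of a k-fold product of Fejer kernels.\<close>

definition fejer_box :: "nat \<Rightarrow> nat \<Rightarrow> (nat \<Rightarrow> nat list) \<Rightarrow> (nat \<Rightarrow> nat) set"
  where "fejer_box k N \<delta> = (\<Pi>\<^sub>E i\<in>{1..k}. {length (\<delta> i)..<length (\<delta> i) + N})"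

definition fejer_weight :: "nat \<Rightarrow> nat \<Rightarrow> (nat \<Rightarrow> nat list) \<Rightarrow> (nat \<Rightarrow> nat list) \<Rightarrow> nat"
  where "fejer_weight k N \<delta> \<gamma> = card (fejer_box k N \<delta> \<inter> fejer_box k N \<gamma>)"

lemma finite_fejer_box: "finite (fejer_box k N \<delta>)"
  unfolding fejer_box_def by (intro finite_PiE) auto

lemma card_fejer_box: "card (fejer_box k N \<delta>) = N ^ k"
  unfolding fejer_box_def by (simp add: card_PiE)

text \<open>Cubes intersect in a product of intervals; the truncated subtraction is 0 exactly when
  the intervals in that coordinate are disjoint.\<close>

lemma fejer_weight_eq:
  "fejer_weight k N \<delta> \<gamma> =
    (\<Prod>i\<in>{1..k}. min (length (\<delta> i)) (length (\<gamma> i)) + N - max (length (\<delta> i)) (length (\<gamma> i)))"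
proof -
  have "fejer_box k N \<delta> \<inter> fejer_box k N \<gamma> =
    (\<Pi>\<^sub>E i\<in>{1..k}. {max (length (\<delta> i)) (length (\<gamma> i))..<min (length (\<delta> i)) (length (\<gamma> i)) + N})"
    unfolding fejer_box_def PiE_Int by (intro PiE_cong) auto
  then show ?thesis
    unfolding fejer_weight_def by (simp add: card_PiE)
qed

lemma fejer_weight_le: "fejer_weight k N \<delta> \<gamma> \<le> N ^ k"
  unfolding fejer_weight_def card_fejer_box[of k N \<delta>, symmetric]
  by (intro card_mono finite_fejer_box) auto

text \<open>Both cubes are shifted alike. The weight thus depends only on the difference of
  multi-lengths, and weighting respects the multi-Toeplitz relation.\<close>

lemma fejer_weight_append:
  "fejer_weight k N (\<delta>(i := \<delta> i @ [s])) (\<gamma>(i := \<gamma> i @ [t])) = fejer_weight k N \<delta> \<gamma>"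
  unfolding fejer_weight_eq by (intro prod.cong) auto

lemma fejer_weight_tendsto:
  "(\<lambda>N. real (fejer_weight k (Suc N) \<delta> \<gamma>) / real (Suc N ^ k)) \<longlonglongrightarrow> 1"
proof -
  have lim: "(\<lambda>N. real (a + Suc N - c) / real (Suc N)) \<longlonglongrightarrow> 1" for a c :: nat
  proof -
    have "(\<lambda>N. 1 + (real a - real c) / real (Suc N)) \<longlonglongrightarrow> 1 + 0"
      by (intro tendsto_intros LIMSEQ_Suc[OF lim_const_over_n])
    \<comment> \<open>For \<open>N \<ge> c\<close> the truncated subtraction is exact.\<close>
    moreover have "\<forall>\<^sub>F N in sequentially. 1 + (real a - real c) / real (Suc N) = real (a + Suc N - c) / real (Suc N)"
      using eventually_ge_at_top[of c] by eventually_elim (auto simp: field_simps of_nat_diff)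
    ultimately show ?thesis by (auto elim: Lim_transform_eventually)
  qed
  have "(\<lambda>N. \<Prod>i\<in>{1..k}. real (min (length (\<delta> i)) (length (\<gamma> i)) + Suc N - max (length (\<delta> i)) (length (\<gamma> i))) / real (Suc N))
    \<longlonglongrightarrow> (\<Prod>i\<in>{1..k}. 1)"
    by (intro tendsto_prod lim)
  then show ?thesis
    by (simp add: fejer_weight_eq prod_dividef)
qed

text \<open>Pairs in which cancelling common last letters has exhausted one of the two words in
  every coordinate, possibly \<open>\<alpha>\<close> in some and \<open>\<beta>\<close> in others.
  For positive \<open>N\<close> the length bound discards only pairs of weight 0.\<close>

definition reduced_pairs :: "nat \<Rightarrow> (nat \<Rightarrow> nat) \<Rightarrow> nat \<Rightarrow> ((nat \<Rightarrow> nat list) \<times> (nat \<Rightarrow> nat list)) set"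
  where "reduced_pairs k n N = {(\<alpha>, \<beta>). \<alpha> \<in> words k n \<and> \<beta> \<in> words k n \<and>
    (\<forall>i. length (\<alpha> i) < N \<and> length (\<beta> i) < N \<and> (\<alpha> i = [] \<or> \<beta> i = []))}"

lemma finite_reduced_pairs: "finite (reduced_pairs k n N)"
proof -
  let ?L = "\<Union>i\<in>{1..k}. {w. set w \<subseteq> {1..n i} \<and> length w \<le> N}"
  let ?F = "{\<alpha>. \<forall>i. (i \<in> {1..k} \<longrightarrow> \<alpha> i \<in> ?L) \<and> (i \<notin> {1..k} \<longrightarrow> \<alpha> i = [])}"
  have "finite ?F"
    by (intro finite_set_of_finite_funs finite_UN_I finite_lists_length_le) auto
  moreover have "\<alpha> \<in> ?F" if "\<alpha> \<in> words k n" "\<And>i. length (\<alpha> i) < N" for \<alpha>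
    using that unfolding words_def by (fastforce intro: less_imp_le)
  then have "reduced_pairs k n N \<subseteq> ?F \<times> ?F"
    unfolding reduced_pairs_def by auto
  ultimately show ?thesis by (meson finite_SigmaI finite_subset)
qed

text \<open>The entry of S_\<alpha>^* S_\<beta> at row \<open>\<delta>\<close> and column
  \<open>\<gamma>\<close> is nonzero when the two products agree. At a reduced position exactly one
  reduced pair contributes, with rows and columns exchanged.\<close>

lemma word_mult_reduced_eq:
  assumes "\<And>i. \<alpha> i = [] \<or> \<beta> i = []" "\<And>i. \<delta> i = [] \<or> \<gamma> i = []"
  shows "word_mult \<alpha> \<delta> = word_mult \<beta> \<gamma> \<longleftrightarrow> \<alpha> = \<gamma> \<and> \<beta> = \<delta>"
proof
  assume *: "word_mult \<alpha> \<delta> = word_mult \<beta> \<gamma>"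
  have "\<alpha> i = \<gamma> i \<and> \<beta> i = \<delta> i" for i
    using fun_cong[OF *, of i] assms(1,2)[of i] by (auto simp: word_mult_def)
  then show "\<alpha> = \<gamma> \<and> \<beta> = \<delta>" by auto
next
  assume *: "\<alpha> = \<gamma> \<and> \<beta> = \<delta>"
  then show "word_mult \<alpha> \<delta> = word_mult \<beta> \<gamma>"
    using assms(2) unfolding word_mult_def fun_eq_iff by (metis append_Nil append_Nil2)
qed

text \<open>Deleting common last letters reduces a pair of words to the unique reduced pair with the same
  matrix coefficient; if this ends at two different last letters, both sides vanish.\<close>

lemma sum_reduced_pairs:
  fixes q :: "(nat \<Rightarrow> nat list) \<Rightarrow> (nat \<Rightarrow> nat list) \<Rightarrow> complex"
  assumes q: "\<And>\<delta> \<gamma> i s t. \<delta> \<in> words k n \<Longrightarrow> \<gamma> \<in> words k n \<Longrightarrow> i \<in> {1..k} \<Longrightarrow> s \<in> {1..n i} \<Longrightarrow> t \<in> {1..n i} \<Longrightarrow>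
      q (\<delta>(i := \<delta> i @ [s])) (\<gamma>(i := \<gamma> i @ [t])) = (if s = t then q \<delta> \<gamma> else 0)"
    and "\<delta> \<in> words k n" "\<gamma> \<in> words k n" and N: "N > 0"
  shows "(\<Sum>(\<alpha>, \<beta>)\<in>reduced_pairs k n N. if word_mult \<alpha> \<delta> = word_mult \<beta> \<gamma> then of_nat (fejer_weight k N \<beta> \<alpha>) * q \<beta> \<alpha> else 0)
    = of_nat (fejer_weight k N \<delta> \<gamma>) * q \<delta> \<gamma>"
  using assms(2,3)
\<comment> \<open>The length of \<open>\<delta>\<close> alone can serve as measure, since a
  cancellation shortens both words.\<close>
proof (induction "\<Sum>i\<in>{1..k}. length (\<delta> i)" arbitrary: \<delta> \<gamma> rule: less_induct)
  case less
  show ?case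
  proof (cases "\<exists>i\<in>{1..k}. \<delta> i \<noteq> [] \<and> \<gamma> i \<noteq> []")
    case True
    then obtain i where i: "i \<in> {1..k}" "\<delta> i \<noteq> []" "\<gamma> i \<noteq> []" by blast
    define \<delta>' \<gamma>' s t where defs: "\<delta>' = \<delta>(i := butlast (\<delta> i))" "\<gamma>' = \<gamma>(i := butlast (\<gamma> i))"
      "s = last (\<delta> i)" "t = last (\<gamma> i)"
    have \<delta>: "\<delta> = \<delta>'(i := \<delta>' i @ [s])" and \<gamma>: "\<gamma> = \<gamma>'(i := \<gamma>' i @ [t])"
      using i by (auto simp: defs)
    have W: "\<delta>' \<in> words k n" "\<gamma>' \<in> words k n"
      using words_inside[OF less.prems(1) i(1)] words_inside[OF less.prems(2) i(1)] less.prems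
      unfolding defs by (intro upd_in_words i(1); auto dest: in_set_butlastD)+
    have st: "s \<in> {1..n i}" "t \<in> {1..n i}"
      using words_inside[OF less.prems(1) i(1)] words_inside[OF less.prems(2) i(1)] i
      unfolding defs by (auto simp: in_lists_conv_set)
    have less': "(\<Sum>i\<in>{1..k}. length (\<delta>' i)) < (\<Sum>i\<in>{1..k}. length (\<delta> i))"
      by (rule sum_strict_mono_ex1) (use i in \<open>auto simp: defs\<close>)
    \<comment> \<open>In coordinate \<open>i\<close> the two products end in \<open>s\<close> and
      \<open>t\<close>, so unequal letters exclude every pair
      \<open>(\<alpha>, \<beta>)\<close>.\<close>
    have eq: "word_mult \<alpha> \<delta> = word_mult \<beta> \<gamma> \<longleftrightarrow> s = t \<and> word_mult \<alpha> \<delta>' = word_mult \<beta> \<gamma>'" for \<alpha> \<beta>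
    proof
      assume *: "word_mult \<alpha> \<delta> = word_mult \<beta> \<gamma>"
      have "s = t" using fun_cong[OF *, of i] by (simp add: \<delta> \<gamma> word_mult_def flip: append_assoc)
      moreover have "\<alpha> j @ \<delta>' j = \<beta> j @ \<gamma>' j" for j
        using fun_cong[OF *, of j] unfolding \<delta> \<gamma> word_mult_def
        by (cases "j = i") (simp_all flip: append_assoc)
      ultimately show "s = t \<and> word_mult \<alpha> \<delta>' = word_mult \<beta> \<gamma>'" by (simp add: word_mult_def)
    next
      assume *: "s = t \<and> word_mult \<alpha> \<delta>' = word_mult \<beta> \<gamma>'"
      then have "\<alpha> j @ \<delta>' j = \<beta> j @ \<gamma>' j" for j by (metis word_mult_def)
      then show "word_mult \<alpha> \<delta> = word_mult \<beta> \<gamma>"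
        using * unfolding \<delta> \<gamma> word_mult_def fun_eq_iff by (simp flip: append_assoc)
    qed
    have w: "fejer_weight k N \<delta> \<gamma> = fejer_weight k N \<delta>' \<gamma>'"
      unfolding \<delta> \<gamma> by (rule fejer_weight_append)
    have q': "q \<delta> \<gamma> = (if s = t then q \<delta>' \<gamma>' else 0)"
      unfolding \<delta> \<gamma> by (rule q[OF W i(1) st])
    show ?thesis
    proof (cases "s = t")
      case True
      then show ?thesis unfolding eq w q' using less.hyps[OF less' W] by simp
    next
      case False
      then show ?thesis unfolding eq w q' by (simp add: case_prod_beta)
    qed
  next
    case False
    then have red: "\<delta> i = [] \<or> \<gamma> i = []" for i
      using words_outside[OF less.prems(1), of i] by blast
    have "(\<Sum>(\<alpha>, \<beta>)\<in>reduced_pairs k n N. if word_mult \<alpha> \<delta> = word_mult \<beta> \<gamma> then of_nat (fejer_weight k N \<beta> \<alpha>) * q \<beta> \<alpha> else 0)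
      = (\<Sum>p\<in>reduced_pairs k n N. if p = (\<gamma>, \<delta>) then of_nat (fejer_weight k N \<delta> \<gamma>) * q \<delta> \<gamma> else 0)"
    proof (intro sum.cong refl, clarify)
      fix \<alpha> \<beta> assume "(\<alpha>, \<beta>) \<in> reduced_pairs k n N"
      then have "word_mult \<alpha> \<delta> = word_mult \<beta> \<gamma> \<longleftrightarrow> \<alpha> = \<gamma> \<and> \<beta> = \<delta>"
        using red by (intro word_mult_reduced_eq) (auto simp: reduced_pairs_def)
      then show "(if word_mult \<alpha> \<delta> = word_mult \<beta> \<gamma> then of_nat (fejer_weight k N \<beta> \<alpha>) * q \<beta> \<alpha> else 0) =
        (if (\<alpha>, \<beta>) = (\<gamma>, \<delta>) then of_nat (fejer_weight k N \<delta> \<gamma>) * q \<delta> \<gamma> else 0)"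
        by auto
    qed
    also have "\<dots> = (if (\<gamma>, \<delta>) \<in> reduced_pairs k n N then of_nat (fejer_weight k N \<delta> \<gamma>) * q \<delta> \<gamma> else 0)"
      by (rule sum.delta[OF finite_reduced_pairs])
    also have "\<dots> = of_nat (fejer_weight k N \<delta> \<gamma>) * q \<delta> \<gamma>"
    proof (cases "(\<gamma>, \<delta>) \<in> reduced_pairs k n N")
      case False
      \<comment> \<open>Some word has length at least \<open>N\<close> while its partner is empty,
        so the cubes are disjoint in that coordinate and the weight is 0.\<close>
      then have "\<exists>i. \<not> (length (\<gamma> i) < N \<and> length (\<delta> i) < N)"
        using less.prems red unfolding reduced_pairs_def by auto
      then obtain i where "\<not> (length (\<gamma> i) < N \<and> length (\<delta> i) < N)"
        by blast
      then have i: "N \<le> max (length (\<delta> i)) (length (\<gamma> i))"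
        by auto
      \<comment> \<open>Outside \<open>{1..k}\<close> both words are empty, and \<open>N > 0\<close>
        excludes this.\<close>
      have ik: "i \<in> {1..k}"
      proof (rule ccontr)
        assume "i \<notin> {1..k}"
        then show False
          using i N words_outside[OF less.prems(1)] words_outside[OF less.prems(2)] by simp
      qed
      have "min (length (\<delta> i)) (length (\<gamma> i)) + N - max (length (\<delta> i)) (length (\<gamma> i)) = 0"
        using red[of i] i by auto
      with ik have "fejer_weight k N \<delta> \<gamma> = 0"
        unfolding fejer_weight_eq by (intro prod_zero) blast+
      then show ?thesis by simp
    qed simp
    finally show ?thesis .
  qed
qed

section \<open>The strong and weak operator topologies\<close>

text \<open>Both operator topologies are pulled back from function spaces with the product topology,
  where convergence is pointwise.\<close>

lemma tendsto_funI:
  fixes f :: "nat \<Rightarrow> 'i \<Rightarrow> 'b::topological_space"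
  assumes "\<And>x. (\<lambda>N. f N x) \<longlonglongrightarrow> g x"
  shows "f \<longlonglongrightarrow> g"
  using limitin_componentwise[of "\<lambda>_. euclidean" UNIV f g sequentially] assms
  by (simp add: euclidean_product_topology)

text \<open>A limit of a sequence lies in the closure without any first countability.\<close>

lemma in_closure_of_pullback:
  fixes f :: "'a \<Rightarrow> 'b::topological_space"
  assumes "\<And>N. X N \<in> S" "(\<lambda>N. f (X N)) \<longlonglongrightarrow> f x"
  shows "x \<in> pullback_topology UNIV f euclidean closure_of S"
  unfolding in_closure_of
proof (intro conjI allI impI)
  show "x \<in> topspace (pullback_topology UNIV f euclidean)"
    by (simp add: topspace_pullback_topology)
  fix T assume "x \<in> T \<and> openin (pullback_topology UNIV f euclidean) T"
  then obtain U where U: "open U" "f x \<in> U" "T = f -` U"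
    unfolding openin_pullback_topology by auto
  have "\<forall>\<^sub>F N in sequentially. f (X N) \<in> U"
    by (rule topological_tendstoD[OF assms(2) U(1,2)])
  then obtain N where "f (X N) \<in> U" using eventually_sequentially by auto
  then show "\<exists>y. y \<in> S \<and> y \<in> T" using assms(1)[of N] U(3) by auto
qed

lemma in_strong_operator_closure:
  assumes "\<And>N. X N \<in> S" "\<And>x. (\<lambda>N. blinfun_apply (X N) x) \<longlonglongrightarrow> blinfun_apply A x"
  shows "A \<in> strong_operator_topology closure_of S"
  unfolding strong_operator_topology_def
  by (rule in_closure_of_pullback[of X]) (intro assms(1) tendsto_funI assms(2))+

lemma in_weak_operator_closure:
  assumes "\<And>N. X N \<in> S" "\<And>x. (\<lambda>N. blinfun_apply (X N) x) \<longlonglongrightarrow> blinfun_apply A x"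
  shows "A \<in> weak_operator_topology closure_of S"
  unfolding weak_operator_topology_def
proof (rule in_closure_of_pullback[of X])
  show "(\<lambda>N (x, y). cinner y (blinfun_apply (X N) x)) \<longlonglongrightarrow> (\<lambda>(x, y). cinner y (blinfun_apply A x))"
    by (rule tendsto_funI)
      (auto intro!: bounded_linear.tendsto[OF bounded_linear_cinner_right] assms(2) simp: case_prod_beta)
qed (rule assms(1))

lemma continuous_map_strong_operator_cinner:
  "continuous_map strong_operator_topology euclidean (\<lambda>A. cinner y (blinfun_apply A x))"
proof -
  have "continuous_map euclidean euclidean (cinner y)"
    using linear_continuous_on[OF bounded_linear_cinner_right] by simp
  from continuous_map_compose[OF strong_operator_topology_continuous_evaluation this]
  show ?thesis by (simp add: o_def)
qed

lemma continuous_map_weak_operator_cinner: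
  "continuous_map weak_operator_topology euclidean (\<lambda>A. cinner y (blinfun_apply A x))"
proof -
  have "continuous_map euclidean euclidean (\<lambda>h. h (x, y) :: complex)"
    by simp
  from continuous_map_pullback[OF this, of UNIV "\<lambda>A (x, y). cinner y (blinfun_apply A x)"]
  show ?thesis by (simp add: o_def weak_operator_topology_def)
qed

lemma topspace_weak_operator_topology: "topspace weak_operator_topology = UNIV"
  by (simp add: weak_operator_topology_def topspace_pullback_topology)

section \<open>Approximation of multi-Toeplitz operators\<close>

context polyball
begin

section \<open>Monomials, matrix coefficients and diagonal operators\<close>

lemma polyball_algebra_id: "id_blinfun \<in> polyball_algebra k n b"
  and polyball_algebra_lcr: "i \<in> {1..k} \<Longrightarrow> j \<in> {1..n i} \<Longrightarrow> lcr i j \<in> polyball_algebra k n b"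
  and polyball_algebra_compose: "a \<in> polyball_algebra k n b \<Longrightarrow> a' \<in> polyball_algebra k n b \<Longrightarrow> a o\<^sub>L a' \<in> polyball_algebra k n b"
  unfolding polyball_algebra_def normclosed_algebra_generated_def by blast+

text \<open>Letters are prepended one at a time. Letters in different coordinates commute, and the
  existential form leaves the order of the coordinates open.\<close>

lemma polyball_algebra_monomial:
  assumes "\<alpha> \<in> W"
  shows "\<exists>a\<in>polyball_algebra k n b. \<forall>\<gamma>\<in>W. a (b \<gamma>) = b (word_mult \<alpha> \<gamma>)"
  using assms
proof (induction "\<Sum>i\<in>{1..k}. length (\<alpha> i)" arbitrary: \<alpha> rule: less_induct)
  case less
  show ?case
  proof (cases "\<exists>i\<in>{1..k}. \<alpha> i \<noteq> []")
    case True
    then obtain i j w where i: "i \<in> {1..k}" "\<alpha> i = j # w" by (metis neq_Nil_conv)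
    have jw: "j \<in> {1..n i}" "w \<in> lists {1..n i}"
      using words_inside[OF less.prems i(1)] i(2) by auto
    have W: "\<alpha>(i := w) \<in> W" by (rule upd_in_words[OF less.prems i(1) jw(2)])
    have "(\<Sum>l\<in>{1..k}. length ((\<alpha>(i := w)) l)) < (\<Sum>l\<in>{1..k}. length (\<alpha> l))"
      by (rule sum_strict_mono_ex1) (use i in auto)
    from less.hyps[OF this W] obtain a where a: "a \<in> polyball_algebra k n b"
      "\<And>\<gamma>. \<gamma> \<in> W \<Longrightarrow> a (b \<gamma>) = b (word_mult (\<alpha>(i := w)) \<gamma>)" by blast
    have "(word_mult (\<alpha>(i := w)) \<gamma>)(i := j # word_mult (\<alpha>(i := w)) \<gamma> i) = word_mult \<alpha> \<gamma>" for \<gamma>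
      using i by (auto simp: word_mult_def)
    then have "(lcr i j o\<^sub>L a) (b \<gamma>) = b (word_mult \<alpha> \<gamma>)" if "\<gamma> \<in> W" for \<gamma>
      using that a(2) left_creation(2)[OF i(1) jw(1) word_mult_in_words[OF W that]] by simp
    then show ?thesis
      using polyball_algebra_compose[OF polyball_algebra_lcr[OF i(1) jw(1)] a(1)] by blast
  next
    case False
    then have "\<alpha> = (\<lambda>_. [])" using words_outside[OF less.prems] by blast
    then show ?thesis
      by (intro bexI[OF _ polyball_algebra_id]) (simp add: word_mult_def)
  qed
qed

lemma spatial_tensor_monomial:
  assumes \<alpha>: "\<alpha> \<in> W" and T: "T \<in> cblinops"
  shows "\<exists>G\<in>M. \<forall>\<gamma>\<in>W. \<forall>u. G (V \<gamma> u) = V (word_mult \<alpha> \<gamma>) (T u)"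
proof -
  obtain a where a: "a \<in> polyball_algebra k n b" "\<And>\<gamma>. \<gamma> \<in> W \<Longrightarrow> a (b \<gamma>) = b (word_mult \<alpha> \<gamma>)"
    using polyball_algebra_monomial[OF \<alpha>] by blast
  have im: "word_mult \<alpha> ` W \<subseteq> W" using word_mult_in_words[OF \<alpha>] by blast
  obtain G where G: "is_tensor_op tens T a G"
    using is_tensor_op_exists[where \<sigma>="word_mult \<alpha>", OF T polyball_algebra_commutes(1)[OF a(1)] a(2) inj_on_subset[OF inj_word_mult subset_UNIV] im] .
  have "G \<in> M"
    unfolding spatial_tensor_def
    using G T a(1) by (intro subsetD[OF closure_subset] complex_vector.span_base) blast
  moreover have "G (V \<gamma> u) = V (word_mult \<alpha> \<gamma>) (T u)" if "\<gamma> \<in> W" for \<gamma> u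
    using G a(2)[OF that] by (simp add: is_tensor_op_def)
  ultimately show ?thesis by blast
qed

text \<open>\<open>T\<close> is the compression V_\<beta>^* A V_\<alpha>, where
  \<open>V \<gamma>\<close> is viewed as an isometry of the coefficient space.\<close>

lemma matrix_coefficient:
  assumes A: "A \<in> cblinops" and W: "\<alpha> \<in> W" "\<beta> \<in> W"
  shows "\<exists>T\<in>cblinops. \<forall>u v. cinner v (blinfun_apply T u) = cinner (V \<beta> v) (blinfun_apply A (V \<alpha> u))"
proof -
  have app: "blinfun_apply (Blinfun (V \<gamma>)) = V \<gamma>" if "\<gamma> \<in> W" for \<gamma>
    using full.bounded_linear_V[OF that] by (rule bounded_linear_Blinfun_apply)
  have V: "Blinfun (V \<gamma>) \<in> cblinops" if "\<gamma> \<in> W" for \<gamma>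
    unfolding cblinops_iff app[OF that] using full.V_scaleC[OF that] by blast
  show ?thesis
    using V W A
    by (intro bexI[of _ "cadj (Blinfun (V \<beta>)) o\<^sub>L A o\<^sub>L Blinfun (V \<alpha>)"])
      (auto simp: cinner_cadj_right app intro!: cblinops_compose cadj_in_cblinops)
qed

text \<open>Real weights make \<open>D\<close> self-adjoint. The last conclusion expresses this by
  coefficients, and also applies to vectors such as \<open>A (V \<gamma> u)\<close> that need not be
  finite sums.\<close>

lemma diagonal_operator:
  fixes w :: "(nat \<Rightarrow> nat list) \<Rightarrow> real"
  assumes w: "\<And>\<delta>. \<bar>w \<delta>\<bar> \<le> 1"
  obtains D where "D \<in> cblinops" "\<And>\<delta> v. \<delta> \<in> W \<Longrightarrow> blinfun_apply D (V \<delta> v) = of_real (w \<delta>) *\<^sub>C V \<delta> v" "norm D \<le> 1"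
    "\<And>\<delta> v x. \<delta> \<in> W \<Longrightarrow> cinner (V \<delta> v) (blinfun_apply D x) = of_real (w \<delta>) * cinner (V \<delta> v) x"
proof -
  have T: "complex_of_real (w \<delta>) *\<^sub>C id_blinfun \<in> cblinops" for \<delta>
    by (simp add: cblinops_iff scaleC_blinfun.rep_eq scaleC_scaleC mult.commute)
  have nT: "norm (complex_of_real (w \<delta>) *\<^sub>C (id_blinfun :: 'e \<Rightarrow>\<^sub>L 'e)) \<le> 1" for \<delta>
    using w[of \<delta>] mult_right_mono[OF w norm_ge_zero]
    by (intro norm_blinfun_bound) (auto simp: scaleC_blinfun.rep_eq norm_scaleC)
  obtain D where D: "D \<in> cblinops"
    "\<And>\<delta> v. \<delta> \<in> W \<Longrightarrow> blinfun_apply D (V \<delta> v) = V (id \<delta>) (blinfun_apply (complex_of_real (w \<delta>) *\<^sub>C id_blinfun) v)" "norm D \<le> 1"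
    by (rule full.operator_exists[where \<sigma>=id and T="\<lambda>\<delta>. complex_of_real (w \<delta>) *\<^sub>C id_blinfun" and K=1], simp)
      (auto simp: T nT intro: that)
  have DV: "D (V \<delta> v) = of_real (w \<delta>) *\<^sub>C V \<delta> v" if "\<delta> \<in> W" for \<delta> v
    using D(2)[OF that] by (simp add: scaleC_blinfun.rep_eq tens_scaleC_left)
  have "cinner (V \<delta> v) (D x) = of_real (w \<delta>) * cinner (V \<delta> v) x" if "\<delta> \<in> W" for \<delta> v x
  proof -
    have "cinner (V \<delta> v) (D x) = cinner (of_real (w \<delta>) *\<^sub>C V \<delta> v) x"
      using full.total_V
    proof (induction x rule: total_induct)
      case (base x)
      then show ?case
        using that by (auto simp: DV cinner_scaleC_left cinner_scaleC_right full.cinner_V)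
    next
      case closed
      show ?case
        by (intro closed_Collect_eq continuous_intros bounded_linear.continuous_on[OF bounded_linear_cinner_right])
    next
      case subspace
      show ?case
        by (auto simp: complex_vector.subspace_def blinfun.add_right cblinopsD[OF D(1)] cinner_add_right cinner_scaleC_right)
    qed
    then show ?thesis by (simp add: cinner_scaleC_left)
  qed
  then show thesis using D(1,3) DV by (intro that)
qed

text \<open>The Fejer mean is \<open>\<Sum> w (S\<^sub>\<alpha>)\<^sup>* (T\<^sub>\<beta>\<^sub>\<alpha> \<otimes> S\<^sub>\<beta>)\<close> over the reduced pairs \<open>(\<alpha>, \<beta>)\<close>, where \<open>T\<^sub>\<beta>\<^sub>\<alpha>\<close> is the
  matrix coefficient of \<open>A\<close> at \<open>(\<beta>, \<alpha>)\<close>.\<close>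

lemma fejer_mean:
  assumes A: "A \<in> multi_toeplitz k n b tens" and N: "N > 0"
  obtains F where "F \<in> cspan {cadj f o\<^sub>L g | f g. f \<in> M \<and> g \<in> M}" "F \<in> cblinops" "norm F \<le> norm A"
    "\<And>\<delta> \<gamma> v u. \<delta> \<in> W \<Longrightarrow> \<gamma> \<in> W \<Longrightarrow> cinner (V \<delta> v) (blinfun_apply F (V \<gamma> u)) =
      of_real (real (fejer_weight k N \<delta> \<gamma>) / real (N ^ k)) * cinner (V \<delta> v) (blinfun_apply A (V \<gamma> u))"
proof -
  have Ac: "A \<in> cblinops" using A multi_toeplitz_iff by blast
  have "\<forall>\<alpha>\<in>W. \<exists>L\<in>M. \<forall>\<gamma>\<in>W. \<forall>u. blinfun_apply L (V \<gamma> u) = V (word_mult \<alpha> \<gamma>) u"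
    using spatial_tensor_monomial[OF _ id_in_cblinops] by simp
  then obtain L where L: "\<And>\<alpha>. \<alpha> \<in> W \<Longrightarrow> L \<alpha> \<in> M"
    "\<And>\<alpha> \<gamma> u. \<alpha> \<in> W \<Longrightarrow> \<gamma> \<in> W \<Longrightarrow> blinfun_apply (L \<alpha>) (V \<gamma> u) = V (word_mult \<alpha> \<gamma>) u"
    by metis
  \<comment> \<open>\<open>u'\<close> is the matrix coefficient of \<open>A\<close> at
    \<open>(\<beta>, \<alpha>)\<close> applied to \<open>u\<close>. Recording only its inner
    products leaves \<open>G\<close> as the sole object to choose.\<close>
  have "\<exists>G\<in>M. \<forall>\<gamma>\<in>W. \<forall>u. \<exists>u'. blinfun_apply G (V \<gamma> u) = V (word_mult \<beta> \<gamma>) u' \<and>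
      (\<forall>v. cinner v u' = cinner (V \<beta> v) (blinfun_apply A (V \<alpha> u)))"
    if "\<alpha> \<in> W" "\<beta> \<in> W" for \<alpha> \<beta>
    using matrix_coefficient[OF Ac that] spatial_tensor_monomial[OF that(2)] by metis
  then obtain G where G: "\<And>\<alpha> \<beta>. \<alpha> \<in> W \<Longrightarrow> \<beta> \<in> W \<Longrightarrow> G \<alpha> \<beta> \<in> M"
    "\<And>\<alpha> \<beta> \<gamma> u. \<alpha> \<in> W \<Longrightarrow> \<beta> \<in> W \<Longrightarrow> \<gamma> \<in> W \<Longrightarrow> \<exists>u'. blinfun_apply (G \<alpha> \<beta>) (V \<gamma> u) = V (word_mult \<beta> \<gamma>) u' \<and>
      (\<forall>v. cinner v u' = cinner (V \<beta> v) (blinfun_apply A (V \<alpha> u)))"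
    by metis
  define Fm where "Fm \<alpha> \<beta> = cadj (L \<alpha>) o\<^sub>L G \<alpha> \<beta>" for \<alpha> \<beta>
  define c where "c \<alpha> \<beta> = complex_of_real (real (fejer_weight k N \<beta> \<alpha>) / real (N ^ k))" for \<alpha> \<beta>
  define F where "F = (\<Sum>(\<alpha>, \<beta>)\<in>reduced_pairs k n N. c \<alpha> \<beta> *\<^sub>C Fm \<alpha> \<beta>)"
  have P: "\<alpha> \<in> W \<and> \<beta> \<in> W" if "(\<alpha>, \<beta>) \<in> reduced_pairs k n N" for \<alpha> \<beta>
    using that by (simp add: reduced_pairs_def)
  have span: "F \<in> cspan {cadj f o\<^sub>L g | f g. f \<in> M \<and> g \<in> M}"
    unfolding F_def
  proof (intro complex_vector.span_sum)
    fix p assume "p \<in> reduced_pairs k n N"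
    then obtain \<alpha> \<beta> where p: "p = (\<alpha>, \<beta>)" "\<alpha> \<in> W" "\<beta> \<in> W" using P by (cases p) auto
    have "Fm \<alpha> \<beta> \<in> {cadj f o\<^sub>L g | f g. f \<in> M \<and> g \<in> M}"
      unfolding Fm_def using L(1)[OF p(2)] G(1)[OF p(2,3)] by blast
    then show "(case p of (\<alpha>, \<beta>) \<Rightarrow> c \<alpha> \<beta> *\<^sub>C Fm \<alpha> \<beta>) \<in> cspan {cadj f o\<^sub>L g | f g. f \<in> M \<and> g \<in> M}"
      unfolding p(1) prod.case by (intro complex_vector.span_scale complex_vector.span_base)
  qed
  then have Fc: "F \<in> cblinops"
    using span_subset_multi_toeplitz multi_toeplitz_iff by blast
  have entries: "cinner (V \<delta> v) (blinfun_apply F (V \<gamma> u)) =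
      of_real (real (fejer_weight k N \<delta> \<gamma>) / real (N ^ k)) * cinner (V \<delta> v) (blinfun_apply A (V \<gamma> u))"
    if W: "\<delta> \<in> W" "\<gamma> \<in> W" for \<delta> \<gamma> v u
  proof -
    let ?q = "\<lambda>\<delta> \<gamma>. cinner (V \<delta> v) (blinfun_apply A (V \<gamma> u))"
    \<comment> \<open>The adjoint of \<open>L \<alpha>\<close>, moved to the left, multiplies the
      row word by \<open>\<alpha>\<close>, while \<open>G \<alpha> \<beta>\<close> multiplies the
      column word by \<open>\<beta>\<close>; orthogonality compares the results.\<close>
    have Fm: "cinner (V \<delta> v) (blinfun_apply (Fm \<alpha> \<beta>) (V \<gamma> u)) = (if word_mult \<alpha> \<delta> = word_mult \<beta> \<gamma> then ?q \<beta> \<alpha> else 0)"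
      if \<alpha>\<beta>: "\<alpha> \<in> W" "\<beta> \<in> W" for \<alpha> \<beta>
    proof -
      obtain u' where u': "blinfun_apply (G \<alpha> \<beta>) (V \<gamma> u) = V (word_mult \<beta> \<gamma>) u'" "\<And>v. cinner v u' = cinner (V \<beta> v) (blinfun_apply A (V \<alpha> u))"
        using G(2)[OF \<alpha>\<beta> W(2)] by blast
      have "cinner (V \<delta> v) (blinfun_apply (Fm \<alpha> \<beta>) (V \<gamma> u)) = cinner (V (word_mult \<alpha> \<delta>) v) (V (word_mult \<beta> \<gamma>) u')"
        using that W by (simp add: Fm_def cinner_cadj_right spatial_tensor_commutes(1) L u'(1))
      then show ?thesis
        using that W by (simp add: full.cinner_V word_mult_in_words u'(2))
    qed
    have "cinner (V \<delta> v) (blinfun_apply F (V \<gamma> u)) =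
      (\<Sum>(\<alpha>, \<beta>)\<in>reduced_pairs k n N. c \<alpha> \<beta> * cinner (V \<delta> v) (blinfun_apply (Fm \<alpha> \<beta>) (V \<gamma> u)))"
      unfolding F_def by (simp add: blinfun.sum_left cinner_sum_right case_prod_beta scaleC_blinfun.rep_eq cinner_scaleC_right)
    also have "\<dots> = (\<Sum>(\<alpha>, \<beta>)\<in>reduced_pairs k n N.
        (if word_mult \<alpha> \<delta> = word_mult \<beta> \<gamma> then of_nat (fejer_weight k N \<beta> \<alpha>) * ?q \<beta> \<alpha> else 0) / of_nat (N ^ k))"
      using P by (intro sum.cong refl) (auto simp: Fm c_def)
    also have "\<dots> = (\<Sum>(\<alpha>, \<beta>)\<in>reduced_pairs k n N.
        if word_mult \<alpha> \<delta> = word_mult \<beta> \<gamma> then of_nat (fejer_weight k N \<beta> \<alpha>) * ?q \<beta> \<alpha> else 0) / of_nat (N ^ k)"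
      by (simp add: sum_divide_distrib case_prod_beta)
    also have "\<dots> = of_nat (fejer_weight k N \<delta> \<gamma>) * ?q \<delta> \<gamma> / of_nat (N ^ k)"
    \<comment> \<open>The recursion demanded of \<open>?q\<close> is the multi-Toeplitz relation on
      word vectors, since right creation operators append letters.\<close>
    proof (subst sum_reduced_pairs[where q="?q", OF _ W N])
      fix \<delta> \<gamma> i s t assume W: "\<delta> \<in> W" "\<gamma> \<in> W" and i: "i \<in> {1..k}" "s \<in> {1..n i}" "t \<in> {1..n i}"
      show "?q (\<delta>(i := \<delta> i @ [s])) (\<gamma>(i := \<gamma> i @ [t])) = (if s = t then ?q \<delta> \<gamma> else 0)"
        unfolding Rcr_V[OF i(1,2) W(1), symmetric] Rcr_V[OF i(1,3) W(2), symmetric]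
        by (rule multi_toeplitzD[OF A i])
    qed simp
    finally show ?thesis by simp
  qed
  have "norm F \<le> norm A"
  \<comment> \<open>The sets in the Schur bound are the cubes, all of cardinality
    \<open>N ^ k\<close>, and their overlaps are the weights.\<close>
  proof (rule full.norm_schur_product_le[OF Fc Ac, of "fejer_box k N" "N ^ k"])
    show "of_nat (N ^ k) * cinner (V \<delta> v) (blinfun_apply F (V \<gamma> u)) =
        of_nat (card (fejer_box k N \<delta> \<inter> fejer_box k N \<gamma>)) * cinner (V \<delta> v) (blinfun_apply A (V \<gamma> u))"
      if "\<gamma> \<in> W" "\<delta> \<in> W" for \<gamma> \<delta> u v
      unfolding entries[OF that(2,1)] fejer_weight_def[symmetric] using N by simp
  qed (use N in \<open>simp_all add: finite_fejer_box card_fejer_box\<close>)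
  with span Fc entries show thesis by (intro that)
qed

lemma multi_toeplitz_approximation:
  assumes A: "A \<in> multi_toeplitz k n b tens"
  obtains F where "\<And>N. F N \<in> cspan {cadj f o\<^sub>L g | f g. f \<in> M \<and> g \<in> M}"
    "\<And>x. (\<lambda>N. blinfun_apply (F N) x) \<longlonglongrightarrow> blinfun_apply A x"
proof -
  have Ac: "A \<in> cblinops" using A multi_toeplitz_iff by blast
  define w where "w N \<delta> \<gamma> = real (fejer_weight k (Suc N) \<delta> \<gamma>) / real (Suc N ^ k)" for N \<delta> \<gamma>
  have w: "\<bar>w N \<delta> \<gamma>\<bar> \<le> 1" for N \<delta> \<gamma>
    using fejer_weight_le[of k "Suc N" \<delta> \<gamma>] unfolding w_def by (simp add: divide_le_eq del: of_nat_power)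
  have ex: "\<exists>F. F \<in> cspan {cadj f o\<^sub>L g | f g. f \<in> M \<and> g \<in> M} \<and> F \<in> cblinops \<and> norm F \<le> norm A \<and>
    (\<forall>\<delta>\<in>W. \<forall>\<gamma>\<in>W. \<forall>v u. cinner (V \<delta> v) (blinfun_apply F (V \<gamma> u)) = of_real (w N \<delta> \<gamma>) * cinner (V \<delta> v) (blinfun_apply A (V \<gamma> u)))" for N
    unfolding w_def by (rule fejer_mean[OF A, of "Suc N"]) auto
  obtain F where "\<forall>N. F N \<in> cspan {cadj f o\<^sub>L g | f g. f \<in> M \<and> g \<in> M} \<and> F N \<in> cblinops \<and> norm (F N) \<le> norm A \<and>
    (\<forall>\<delta>\<in>W. \<forall>\<gamma>\<in>W. \<forall>v u. cinner (V \<delta> v) (blinfun_apply (F N) (V \<gamma> u)) = of_real (w N \<delta> \<gamma>) * cinner (V \<delta> v) (blinfun_apply A (V \<gamma> u)))"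
    using choice[OF allI[OF ex]] ..
  then have F: "\<And>N. F N \<in> cspan {cadj f o\<^sub>L g | f g. f \<in> M \<and> g \<in> M}" "\<And>N. F N \<in> cblinops" "\<And>N. norm (F N) \<le> norm A"
    "\<And>N \<delta> \<gamma> v u. \<delta> \<in> W \<Longrightarrow> \<gamma> \<in> W \<Longrightarrow> cinner (V \<delta> v) (blinfun_apply (F N) (V \<gamma> u)) = of_real (w N \<delta> \<gamma>) * cinner (V \<delta> v) (blinfun_apply A (V \<gamma> u))"
    by simp_all
  have lim_V: "(\<lambda>N. blinfun_apply (F N) (V \<gamma> u)) \<longlonglongrightarrow> blinfun_apply A (V \<gamma> u)" if \<gamma>: "\<gamma> \<in> W" for \<gamma> u
  proof -
    \<comment> \<open>In a fixed column \<open>\<gamma>\<close> the weight is a function of the row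
      alone, hence a diagonal operator applied after \<open>A\<close>.\<close>
    have ex: "\<exists>D. D \<in> cblinops \<and> (\<forall>\<delta>\<in>W. \<forall>v. blinfun_apply D (V \<delta> v) = of_real (w N \<delta> \<gamma>) *\<^sub>C V \<delta> v) \<and> norm D \<le> 1 \<and>
      (\<forall>\<delta>\<in>W. \<forall>v x. cinner (V \<delta> v) (blinfun_apply D x) = of_real (w N \<delta> \<gamma>) * cinner (V \<delta> v) x)" for N
      by (rule diagonal_operator[of "\<lambda>\<delta>. w N \<delta> \<gamma>", OF w]) auto
    obtain D where "\<forall>N. D N \<in> cblinops \<and> (\<forall>\<delta>\<in>W. \<forall>v. blinfun_apply (D N) (V \<delta> v) = of_real (w N \<delta> \<gamma>) *\<^sub>C V \<delta> v) \<and> norm (D N) \<le> 1 \<and>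
      (\<forall>\<delta>\<in>W. \<forall>v x. cinner (V \<delta> v) (blinfun_apply (D N) x) = of_real (w N \<delta> \<gamma>) * cinner (V \<delta> v) x)"
      using choice[OF allI[OF ex]] ..
    then have D: "\<And>N. D N \<in> cblinops" "\<And>N \<delta> v. \<delta> \<in> W \<Longrightarrow> blinfun_apply (D N) (V \<delta> v) = of_real (w N \<delta> \<gamma>) *\<^sub>C V \<delta> v"
      "\<And>N. norm (D N) \<le> 1" "\<And>N \<delta> v x. \<delta> \<in> W \<Longrightarrow> cinner (V \<delta> v) (blinfun_apply (D N) x) = of_real (w N \<delta> \<gamma>) * cinner (V \<delta> v) x"
      by simp_all
    have eq: "blinfun_apply (F N) (V \<gamma> u) = D N (A (V \<gamma> u))" for N
      by (rule full.V_ext) (simp add: F(4) D(4) \<gamma>)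
    have "(\<lambda>N. blinfun_apply (D N - id_blinfun) x) \<longlonglongrightarrow> 0" for x
      using full.total_V
    proof (rule null_sequence_total)
      show "D N - id_blinfun \<in> cblinops" for N
        by (intro complex_vector.subspace_diff[OF csubspace_cblinops] D(1) id_in_cblinops)
      show "norm (D N - id_blinfun) \<le> 2" for N
        using norm_triangle_ineq4[of "D N" id_blinfun] D(3)[of N] norm_blinfun_id_le[where 'a='h] by linarith
      fix x assume "x \<in> {V \<delta> v |\<delta> v. \<delta> \<in> W}"
      then obtain \<delta> v where x: "x = V \<delta> v" "\<delta> \<in> W" by blast
      have "(\<lambda>N. (w N \<delta> \<gamma> - 1) *\<^sub>R x) \<longlonglongrightarrow> (1 - 1) *\<^sub>R x"
        unfolding w_def by (intro tendsto_intros fejer_weight_tendsto)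
      moreover have "blinfun_apply (D N - id_blinfun) x = (w N \<delta> \<gamma> - 1) *\<^sub>R x" for N
        using x D(2) by (simp add: blinfun.diff_left scaleR_left_diff_distrib scaleR_scaleC[of "w N \<delta> \<gamma>"])
      ultimately show "(\<lambda>N. blinfun_apply (D N - id_blinfun) x) \<longlonglongrightarrow> 0" by simp
    qed
    then have "(\<lambda>N. D N (A (V \<gamma> u)) - A (V \<gamma> u)) \<longlonglongrightarrow> 0"
      by (simp add: blinfun.diff_left)
    then show ?thesis unfolding eq by (rule LIM_zero_cancel)
  qed
  \<comment> \<open>Convergence of the columns extends to all vectors by the uniform bound
    \<open>2 * norm A\<close>.\<close>
  have "(\<lambda>N. blinfun_apply (F N - A) x) \<longlonglongrightarrow> 0" for x
    using full.total_V
  proof (rule null_sequence_total)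
    show "F N - A \<in> cblinops" for N
      by (intro complex_vector.subspace_diff[OF csubspace_cblinops] F(2) Ac)
    show "norm (F N - A) \<le> 2 * norm A" for N
      using norm_triangle_ineq4[of "F N" A] F(3)[of N] by linarith
    fix x assume "x \<in> {V \<gamma> u |\<gamma> u. \<gamma> \<in> W}"
    then show "(\<lambda>N. blinfun_apply (F N - A) x) \<longlonglongrightarrow> 0"
      using lim_V by (auto simp: blinfun.diff_left intro: LIM_zero)
  qed
  then have "(\<lambda>N. blinfun_apply (F N) x) \<longlonglongrightarrow> blinfun_apply A x" for x
    unfolding blinfun.diff_left by (rule LIM_zero_cancel)
  with F(1) show thesis by (rule that)
qed

lemma multi_toeplitz_closure:
  "multi_toeplitz k n b tens = strong_operator_topology closure_of (cspan {cadj f o\<^sub>L g | f g. f \<in> M \<and> g \<in> M})"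
  "multi_toeplitz k n b tens = weak_operator_topology closure_of (cspan {cadj f o\<^sub>L g | f g. f \<in> M \<and> g \<in> M})"
proof -
  let ?S = "cspan {cadj f o\<^sub>L g | f g. f \<in> M \<and> g \<in> M}"
  have "A \<in> strong_operator_topology closure_of ?S" "A \<in> weak_operator_topology closure_of ?S"
    if "A \<in> multi_toeplitz k n b tens" for A
    by (rule multi_toeplitz_approximation[OF that], rule in_strong_operator_closure, assumption+)
      (rule multi_toeplitz_approximation[OF that], rule in_weak_operator_closure, assumption+)
  moreover have "strong_operator_topology closure_of ?S \<subseteq> multi_toeplitz k n b tens"
    by (intro closure_of_minimal span_subset_multi_toeplitz closedin_multi_toeplitz
        strong_operator_topology_topspace continuous_map_strong_operator_cinner)
  moreover have "weak_operator_topology closure_of ?S \<subseteq> multi_toeplitz k n b tens"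
    by (intro closure_of_minimal span_subset_multi_toeplitz closedin_multi_toeplitz
        topspace_weak_operator_topology continuous_map_weak_operator_cinner)
  ultimately show "multi_toeplitz k n b tens = strong_operator_topology closure_of ?S"
    "multi_toeplitz k n b tens = weak_operator_topology closure_of ?S" by blast+
qed

end

theorem theorem1p7:
  fixes k :: nat and n :: "nat \<Rightarrow> nat"
    and e :: "nat \<Rightarrow> nat \<Rightarrow> 'x::chilbert_space"
    and t :: "nat \<Rightarrow> 'x list \<Rightarrow> 'a::chilbert_space"
    and \<tau> :: "(nat \<Rightarrow> 'a) \<Rightarrow> 'f::chilbert_space"
    and tens :: "'e::chilbert_space \<Rightarrow> 'f \<Rightarrow> 'h::chilbert_space"
  defines "H \<equiv> \<lambda>i. cspan (e i ` {1..n i})"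
  defines "b \<equiv> fock_basis k e t \<tau>"
  defines "M \<equiv> spatial_tensor tens cblinops (polyball_algebra k n b)"
  assumes "k \<ge> 1" and "\<And>i. i \<in> {1..k} \<Longrightarrow> n i \<ge> 1"
    and "\<And>i. i \<in> {1..k} \<Longrightarrow> orthonormal_family {1..n i} (e i)"
    and "\<And>i. i \<in> {1..k} \<Longrightarrow> full_fock (H i) (t i)"
    and "hilbert_tensor_family {1..k} (\<lambda>i. fock_space (H i) (t i)) \<tau>"
    and "hilbert_tensor tens"
  shows "multi_toeplitz k n b tens =
           strong_operator_topology closure_of (cspan {cadj f o\<^sub>L g | f g. f \<in> M \<and> g \<in> M}) \<and>
         multi_toeplitz k n b tens =
           weak_operator_topology closure_of (cspan {cadj f o\<^sub>L g | f g. f \<in> M \<and> g \<in> M})"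
proof -
  interpret polyball tens k n b
    unfolding b_def
  proof
    show "hilbert_tensor tens" by fact
    show "cinner (fock_basis k e t \<tau> \<alpha>) (fock_basis k e t \<tau> \<beta>) = (if \<alpha> = \<beta> then 1 else 0)"
      if "\<alpha> \<in> words k n" "\<beta> \<in> words k n" for \<alpha> \<beta>
      using assms(6,7,8) that unfolding H_def by (rule fock_basis_orthonormal)
    show "closure (cspan (fock_basis k e t \<tau> ` words k n)) = UNIV"
      using assms(6,7,8) unfolding H_def by (rule fock_basis_total)
  qed
  show ?thesis
    unfolding M_def using multi_toeplitz_closure by blast
qed

end
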